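(* Let $d\ge3$, $1\le k\le d$, and $A=\{x\in\mathbb Z^d: x_1\ge1,\dots,x_k\ge1\}$. Then for all $x,y\in A$, $$G_A(x,y)\asymp(1+|x-y|)^{2-d}\prod_{i=1}^k\Big(1\wedge\frac{x_iy_i}{(1+|x-y|)^2}\Big),$$ with implicit constants depending only on $d$ and $k$.
   Context: $\mathbb Z^d$ carries unit weights on nearest-neighbour edges ($\mu_{xy}=1$ iff $\|x-y\|_1=1$), so $\mu(x)=2d$. $G_A(x,y)$ is the Dirichlet Green function of $A$: $G_A(x,y)=\frac1{2d}\sum_{n\ge0}\mathbb P_x(S_n=y,\ n<\tau_{A^c})$, where $(S_n)$ is simple random walk on $\mathbb Z^d$ and $\tau_{A^c}$ its first hitting time of $\mathbb Z^d\setminus A$. $|\cdot|$ is the Euclidean norm, $a\wedge b=\min\{a,b\}$, and $f\asymp g$ means $C^{-1}g\le f\le Cg$. *)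

theory Defs
  imports "HOL-Analysis.Analysis"
begin

text \<open>Points of Z^d are represented as functions x :: nat => int that vanish
  outside the coordinates 0..d-1; coordinate i (0-based) is x_{i+1} of the paper.\<close>

definition lattice :: "nat \<Rightarrow> (nat \<Rightarrow> int) set" where
  "lattice d = {x. \<forall>i\<ge>d. x i = 0}"

definition orthant :: "nat \<Rightarrow> nat \<Rightarrow> (nat \<Rightarrow> int) set" where
  "orthant d k = {x \<in> lattice d. \<forall>i<k. x i \<ge> 1}"

text \<open>killed_prob d A n x y = P_x(S_n = y, n < tau_{A^c}) for simple random walk
  on Z^d: the walk starts at x and every step moves to one of the 2d nearest
  neighbours with probability 1/(2d); the event requires S_0,...,S_n all in A.\<close>
fun killed_prob :: "nat \<Rightarrow> (nat \<Rightarrow> int) set \<Rightarrow> nat \<Rightarrow> (nat \<Rightarrow> int) \<Rightarrow> (nat \<Rightarrow> int) \<Rightarrow> real" where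
  "killed_prob d A 0 x y = (if x \<in> A \<and> x = y then 1 else 0)"
| "killed_prob d A (Suc n) x y =
     (if x \<in> A then
        (\<Sum>i<d. killed_prob d A n (x(i := x i + 1)) y + killed_prob d A n (x(i := x i - 1)) y)
          / (2 * real d)
      else 0)"

definition green :: "nat \<Rightarrow> (nat \<Rightarrow> int) set \<Rightarrow> (nat \<Rightarrow> int) \<Rightarrow> (nat \<Rightarrow> int) \<Rightarrow> real" where
  "green d A x y = (\<Sum>n. killed_prob d A n x y) / (2 * real d)"

definition edist :: "nat \<Rightarrow> (nat \<Rightarrow> int) \<Rightarrow> (nat \<Rightarrow> int) \<Rightarrow> real" where
  "edist d x y = sqrt (\<Sum>i<d. (real_of_int (x i - y i))\<^sup>2)"

end

theory Submission
  imports Defs "HOL-Probability.Distributions"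
begin

text \<open>
  Running the walk at the jump times of a Poisson process makes its coordinates independent, so that
  the Green function of the orthant becomes the integral over $t \ge 0$ of a product of
  one-dimensional continuous-time kernels: $p_t(x_i - y_i)$ for a free coordinate and
  $p_t(x_i - y_i) - p_t(x_i + y_i)$ for a killed one, where $p_t(c) = e^{-2t} I_c(2t)$.

  The recurrence $c\, p_t(c) = t\,(p_t(c-1) - p_t(c+1))$ drives the estimates. Telescoping, it expresses
  the killed kernel as a sum of $(c/t)\, p_t(c)$ over $\min(a,b)$ values of $c$ adding up to $ab$, which
  gives the factor $\min(1, ab/t)$; summed over all $c \ge 1$ it bounds $p_t(0) + p_t(1)$ by a first
  moment, hence by a multiple of $t^{-1/2}$. Exponential moments and the total mass give the decay
  and the lower bounds. The integral is then dominated by times of order $(1 + |x-y|)^2$.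
\<close>

unbundle fps_syntax and no vec_syntax

section \<open>Bessel power series\<close>

definition inv_fact :: "int \<Rightarrow> real" where
  "inv_fact u = (if u \<ge> 0 then 1 / fact (nat u) else 0)"

text \<open>Extending the reciprocal factorial by zero makes this recurrence valid at every integer,
  in particular at \<open>u = 0\<close>. The path counts below therefore need no special treatment
  of paths that only go up or only go down.\<close>

lemma inv_fact_rec: "of_int u * inv_fact u = inv_fact (u - 1)"
proof (cases "u \<ge> 1")
  case True
  then have "nat u = Suc (nat (u - 1))" by simp
  then have "(fact (nat u) :: real) = of_int u * fact (nat (u - 1))"
    using True by (metis fact_Suc of_nat_nat order_trans zero_le_one of_int_of_nat_eq of_nat_mult)
  then show ?thesis using True by (simp add: inv_fact_def)
qed (auto simp: inv_fact_def)

lemma inv_fact_nonneg: "inv_fact u \<ge> 0"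
  by (simp add: inv_fact_def)

text \<open>The power series of the modified Bessel function $I_c(2t)$: its $n$-th coefficient is the
  number of nearest-neighbour paths of length $n$ in $\mathbb{Z}$ from $0$ to $c$, divided by $n!$.\<close>

definition bessel_fps :: "int \<Rightarrow> real fps" where
  "bessel_fps c = Abs_fps (\<lambda>n. if even (int n + c)
     then inv_fact ((int n + c) div 2) * inv_fact ((int n - c) div 2) else 0)"

lemma bessel_fps_nth:
  "bessel_fps c $ n = (if even (int n + c)
     then inv_fact ((int n + c) div 2) * inv_fact ((int n - c) div 2) else 0)"
  by (simp add: bessel_fps_def)

lemma bessel_fps_nth_nonneg: "bessel_fps c $ n \<ge> 0"
  by (simp add: bessel_fps_nth inv_fact_nonneg)

lemma bessel_fps_minus: "bessel_fps (- c) = bessel_fps c"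
  by (rule fps_ext) (simp add: bessel_fps_nth mult.commute)

lemma bessel_fps_abs: "bessel_fps \<bar>c\<bar> = bessel_fps c"
  by (simp add: abs_if bessel_fps_minus)

lemma bessel_fps_nth_0: "bessel_fps c $ 0 = (if c = 0 then 1 else 0)"
  by (auto simp: bessel_fps_nth inv_fact_def elim!: evenE)

text \<open>A path of \<open>Suc n\<close> steps ending at \<open>c\<close> has \<open>u\<close>
  up-steps and \<open>v\<close> down-steps with \<open>u + v = Suc n\<close> and
  \<open>u - v = c\<close>, and its coefficient is \<open>1 / (u! v!)\<close>. Multiplying by
  \<open>u + v\<close> or by \<open>u - v\<close> and cancelling one factor of a factorial gives the
  two identities: the first becomes the heat equation, the second the Bessel recurrence.\<close>

lemma bessel_fps_nth_shift:
  shows "of_nat (Suc n) * bessel_fps c $ Suc n = bessel_fps (c - 1) $ n + bessel_fps (c + 1) $ n"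
    and "of_int c * bessel_fps c $ Suc n = bessel_fps (c - 1) $ n - bessel_fps (c + 1) $ n"
proof -
  have "of_nat (Suc n) * bessel_fps c $ Suc n = bessel_fps (c - 1) $ n + bessel_fps (c + 1) $ n \<and>
        of_int c * bessel_fps c $ Suc n = bessel_fps (c - 1) $ n - bessel_fps (c + 1) $ n"
  proof (cases "even (int (Suc n) + c)")
    case True
    then obtain u where u: "int (Suc n) + c = 2 * u" by (elim evenE)
    define v where "v = int (Suc n) - u"
    have n: "int n = u + v - 1" and c: "c = u - v" using u by (auto simp: v_def)
    have 1: "bessel_fps c $ Suc n = inv_fact u * inv_fact v"
      using n c by (simp add: bessel_fps_nth)
    have 2: "bessel_fps (c - 1) $ n = inv_fact (u - 1) * inv_fact v"
      using n c by (auto simp: bessel_fps_nth)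
    have 3: "bessel_fps (c + 1) $ n = inv_fact u * inv_fact (v - 1)"
      using n c by (auto simp: bessel_fps_nth)
    have sn: "real (Suc n) = of_int u + of_int v"
      using n by (metis add.commute diff_add_cancel of_int_add of_int_of_nat_eq of_nat_Suc of_int_1)
    have cr: "(of_int c :: real) = of_int u - of_int v" using c by simp
    show ?thesis
      unfolding sn cr 1 2 3 inv_fact_rec[symmetric] by (simp add: algebra_simps)
  next
    case False
    then have "odd (int n + (c - 1))" "odd (int n + (c + 1))" by auto
    with False show ?thesis by (simp add: bessel_fps_nth)
  qed
  then show "of_nat (Suc n) * bessel_fps c $ Suc n = bessel_fps (c - 1) $ n + bessel_fps (c + 1) $ n"
    and "of_int c * bessel_fps c $ Suc n = bessel_fps (c - 1) $ n - bessel_fps (c + 1) $ n" by blast+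
qed

lemma bessel_fps_deriv: "fps_deriv (bessel_fps c) = bessel_fps (c - 1) + bessel_fps (c + 1)"
  using bessel_fps_nth_shift(1) by (intro fps_ext) simp

lemma bessel_fps_rec: "fps_const (of_int c) * bessel_fps c = fps_X * (bessel_fps (c - 1) - bessel_fps (c + 1))"
proof (rule fps_ext)
  fix n show "(fps_const (of_int c) * bessel_fps c) $ n = (fps_X * (bessel_fps (c - 1) - bessel_fps (c + 1))) $ n"
    using bessel_fps_nth_shift(2) by (cases n) (auto simp: bessel_fps_nth_0)
qed

text \<open>Coefficient form of the Laurent expansion of \<open>exp (t * (z + 1 / z))\<close>. All
  terms are nonnegative, so an inequality over arbitrary finite sets is enough; arbitrary sets are
  also what the induction needs, since each step shifts \<open>S\<close> by one in both
  directions.\<close>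

lemma bessel_fps_nth_mgf_le:
  fixes z :: real
  assumes "z > 0" "finite S"
  shows "(\<Sum>c\<in>S. bessel_fps c $ n * z powi c) \<le> (z + 1 / z) ^ n / fact n"
  using assms(2)
proof (induction n arbitrary: S)
  case 0
  have "(\<Sum>c\<in>S. bessel_fps c $ 0 * z powi c) = (\<Sum>c\<in>S. if c = 0 then 1 else 0)"
    by (intro sum.cong) (auto simp: bessel_fps_nth_0)
  also have "\<dots> \<le> 1" using 0 by simp
  finally show ?case by simp
next
  case (Suc n)
  have "real (Suc n) * (\<Sum>c\<in>S. bessel_fps c $ Suc n * z powi c)
      = (\<Sum>c\<in>S. (real (Suc n) * bessel_fps c $ Suc n) * z powi c)"
    by (simp only: sum_distrib_left mult.assoc)
  also have "\<dots> = (\<Sum>c\<in>S. bessel_fps (c - 1) $ n * z powi c) + (\<Sum>c\<in>S. bessel_fps (c + 1) $ n * z powi c)"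
    by (simp only: bessel_fps_nth_shift(1) distrib_right sum.distrib)
  also have "(\<Sum>c\<in>S. bessel_fps (c - 1) $ n * z powi c) = z * (\<Sum>c\<in>(\<lambda>c. c - 1) ` S. bessel_fps c $ n * z powi c)"
    using assms(1)
    by (subst sum.reindex) (auto simp: inj_on_def sum_distrib_left power_int_diff intro!: sum.cong)
  also have "(\<Sum>c\<in>S. bessel_fps (c + 1) $ n * z powi c) = 1 / z * (\<Sum>c\<in>(\<lambda>c. c + 1) ` S. bessel_fps c $ n * z powi c)"
    using assms(1)
    by (subst sum.reindex) (auto simp: inj_on_def sum_distrib_left power_int_add intro!: sum.cong)
  also have "z * (\<Sum>c\<in>(\<lambda>c. c - 1) ` S. bessel_fps c $ n * z powi c) + 1 / z * (\<Sum>c\<in>(\<lambda>c. c + 1) ` S. bessel_fps c $ n * z powi c)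
     \<le> z * ((z + 1 / z) ^ n / fact n) + 1 / z * ((z + 1 / z) ^ n / fact n)"
    using assms(1) Suc.prems by (intro add_mono mult_left_mono Suc.IH) auto
  also have "\<dots> = real (Suc n) * ((z + 1 / z) ^ Suc n / fact (Suc n))"
    by (simp add: field_simps del: of_nat_Suc)
  finally show ?case
    by (subst (asm) mult_le_cancel_left_pos) simp_all
qed

text \<open>A path of length \<open>n\<close> cannot leave \<open>{- int n..int n}\<close>. The
  endpoints stay general because the induction shifts the interval by one either way, and the
  shifted intervals still contain the range of the shorter paths.\<close>

lemma bessel_fps_nth_total:
  assumes "l \<le> - int n" "int n \<le> u"
  shows "(\<Sum>c\<in>{l..u}. bessel_fps c $ n) = 2 ^ n / fact n"
  using assms
proof (induction n arbitrary: l u)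
  case 0
  then show ?case by (simp add: bessel_fps_nth_0)
next
  case (Suc n)
  have "real (Suc n) * (\<Sum>c\<in>{l..u}. bessel_fps c $ Suc n)
      = (\<Sum>c\<in>{l..u}. bessel_fps (c - 1) $ n) + (\<Sum>c\<in>{l..u}. bessel_fps (c + 1) $ n)"
    by (simp only: sum_distrib_left bessel_fps_nth_shift(1) sum.distrib)
  also have "(\<Sum>c\<in>{l..u}. bessel_fps (c - 1) $ n) = (\<Sum>c\<in>{l - 1..u - 1}. bessel_fps c $ n)"
    by (rule sum.reindex_bij_witness[of _ "\<lambda>c. c + 1" "\<lambda>c. c - 1"]) auto
  also have "(\<Sum>c\<in>{l..u}. bessel_fps (c + 1) $ n) = (\<Sum>c\<in>{l + 1..u + 1}. bessel_fps c $ n)"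
    by (rule sum.reindex_bij_witness[of _ "\<lambda>c. c - 1" "\<lambda>c. c + 1"]) auto
  also have "(\<Sum>c\<in>{l - 1..u - 1}. bessel_fps c $ n) + (\<Sum>c\<in>{l + 1..u + 1}. bessel_fps c $ n)
       = 2 * (2 ^ n / fact n)"
    using Suc.prems by (subst (1 2) Suc.IH) auto
  also have "\<dots> = real (Suc n) * (2 ^ Suc n / fact (Suc n))"
    by (simp add: field_simps del: of_nat_Suc)
  finally show ?case
    by (subst (asm) mult_left_cancel) simp_all
qed

lemma bessel_fps_nth_le: "bessel_fps c $ n \<le> 2 ^ n / fact n"
  using bessel_fps_nth_mgf_le[of 1 "{c}" n] by simp

lemma bessel_fps_conv_radius [simp]: "fps_conv_radius (bessel_fps c) = \<infinity>"
proof -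
  have "summable (\<lambda>n. bessel_fps c $ n * z ^ n)" for z
  proof (rule summable_comparison_test')
    show "summable (\<lambda>n. (2 * \<bar>z\<bar>) ^ n /\<^sub>R fact n)"
      by (rule summable_exp_generic)
    show "norm (bessel_fps c $ n * z ^ n) \<le> (2 * \<bar>z\<bar>) ^ n /\<^sub>R fact n" for n
      using mult_right_mono[OF bessel_fps_nth_le, of "\<bar>z\<bar> ^ n" c n] bessel_fps_nth_nonneg[of c n]
      by (simp add: abs_mult power_abs power_mult_distrib divide_inverse mult_ac)
  qed
  then show ?thesis
    unfolding fps_conv_radius_def by (intro conv_radius_inftyI'')
qed

text \<open>Multiplication by the exponential makes the walk lazy. Without laziness the coefficients
  vanish for one of the two parities, so they are not monotone in $c$.\<close>

lemma bessel_fps_nth_exp_mono: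
  assumes "c \<ge> 0"
  shows "(fps_exp 1 * bessel_fps (c + 1)) $ n \<le> (fps_exp 1 * bessel_fps c) $ n"
  using assms
proof (induction n arbitrary: c)
  case 0
  then show ?case by (simp add: bessel_fps_nth_0 fps_mult_nth_0)
next
  case (Suc n)
  define L where "L c = fps_exp 1 * bessel_fps c" for c
  have step: "real (Suc n) * L c $ Suc n = L c $ n + L (c - 1) $ n + L (c + 1) $ n" for c
  proof -
    have "fps_deriv (L c) = L c + L (c - 1) + L (c + 1)"
      by (simp add: L_def bessel_fps_deriv algebra_simps)
    then have "fps_deriv (L c) $ n = (L c + L (c - 1) + L (c + 1)) $ n" by simp
    then show ?thesis by simp
  qed
  have IH: "L (c + 1) $ n \<le> L c $ n" if "c \<ge> 0" for c
    using Suc.IH[OF that] by (simp add: L_def)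
  \<comment> \<open>After cancellation the goal is \<open>L (c + 2) $ n \<le> L (c - 1) $ n\<close>.
    For \<open>c \<ge> 1\<close> this is three uses of the induction hypothesis; for
    \<open>c = 0\<close> the index \<open>c - 1\<close> leaves its range, and symmetry turns the
    goal into a comparison of \<open>L 2\<close> with \<open>L 1\<close>.\<close>
  have "L (- 1) = L 1" using bessel_fps_minus[of 1] by (simp add: L_def)
  then have "L (c + 1) $ n + L c $ n + L (c + 2) $ n \<le> L c $ n + L (c - 1) $ n + L (c + 1) $ n"
    using IH[of "c - 1"] IH[of c] IH[of "c + 1"] Suc.prems by (cases "c = 0") (auto simp: add.assoc)
  then have "real (Suc n) * L (c + 1) $ Suc n \<le> real (Suc n) * L c $ Suc n"
    unfolding step by (simp add: algebra_simps)
  then show ?case by (simp add: L_def del: of_nat_Suc)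
qed

section \<open>The one-dimensional heat kernel and its killed version\<close>

definition heat :: "real \<Rightarrow> int \<Rightarrow> real" where
  "heat t c = exp (- 2 * t) * eval_fps (bessel_fps c) t"

lemma heat_minus: "heat t (- c) = heat t c" and heat_abs: "heat t \<bar>c\<bar> = heat t c"
  by (simp_all add: heat_def bessel_fps_minus bessel_fps_abs)

lemma bessel_fps_sums: "(\<lambda>n. bessel_fps c $ n * t ^ n) sums eval_fps (bessel_fps c) t"
  by (rule sums_eval_fps) simp

lemma heat_nonneg: "t \<ge> 0 \<Longrightarrow> heat t c \<ge> 0"
  unfolding heat_def
  by (intro mult_nonneg_nonneg sums_le[OF _ sums_zero bessel_fps_sums]) (simp_all add: bessel_fps_nth_nonneg)

lemma heat_rec: "of_int c * heat t c = t * (heat t (c - 1) - heat t (c + 1))"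
proof -
  have "eval_fps (fps_const (of_int c) * bessel_fps c) t = eval_fps (fps_X * (bessel_fps (c - 1) - bessel_fps (c + 1))) t"
    by (simp only: bessel_fps_rec)
  moreover have "fps_conv_radius (bessel_fps (c - 1) - bessel_fps (c + 1)) = \<infinity>"
    using fps_conv_radius_diff[of "bessel_fps (c - 1)" "bessel_fps (c + 1)"] by simp
  ultimately have "of_int c * eval_fps (bessel_fps c) t = t * (eval_fps (bessel_fps (c - 1)) t - eval_fps (bessel_fps (c + 1)) t)"
    by (simp add: eval_fps_mult eval_fps_diff)
  then have "exp (- 2 * t) * (of_int c * eval_fps (bessel_fps c) t)
      = exp (- 2 * t) * (t * (eval_fps (bessel_fps (c - 1)) t - eval_fps (bessel_fps (c + 1)) t))" by simp
  then show ?thesis by (simp add: heat_def algebra_simps)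
qed

text \<open>Coefficientwise comparison is available only after multiplication by the exponential
  series, but evaluation turns that factor into the positive number \<open>exp t\<close>, which
  cancels.\<close>

lemma heat_step_mono:
  assumes "c \<ge> 0" "t \<ge> 0"
  shows "heat t (c + 1) \<le> heat t c"
proof -
  have cr: "fps_conv_radius (fps_exp 1 * bessel_fps c) = \<infinity>" for c
    using fps_conv_radius_mult[of "fps_exp 1" "bessel_fps c"] by simp
  have "eval_fps (fps_exp 1 * bessel_fps (c + 1)) t \<le> eval_fps (fps_exp 1 * bessel_fps c) t"
    by (rule sums_le[OF _ sums_eval_fps sums_eval_fps])
       (use assms bessel_fps_nth_exp_mono in \<open>auto simp: cr intro!: mult_right_mono\<close>)
  then show ?thesis by (simp add: heat_def eval_fps_mult)
qed

lemma heat_mono: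
  assumes "\<bar>c\<bar> \<le> \<bar>c'\<bar>" "t \<ge> 0"
  shows "heat t c' \<le> heat t c"
proof -
  have "heat t n \<le> heat t m" if "0 \<le> m" "m \<le> n" for m n
    using that(2)
  proof (induction n rule: int_ge_induct)
    case (step i)
    then show ?case using heat_step_mono[of i t] assms(2) that(1) by simp
  qed simp
  from this[of "\<bar>c\<bar>" "\<bar>c'\<bar>"] show ?thesis using assms(1) by (simp add: heat_abs)
qed

lemma heat_mgf_le:
  assumes "z > 0" "finite S" "t \<ge> 0"
  shows "(\<Sum>c\<in>S. heat t c * z powi c) \<le> exp (t * (z + 1 / z - 2))"
proof -
  have A: "(\<lambda>n. \<Sum>c\<in>S. (bessel_fps c $ n * t ^ n) * z powi c) sums (\<Sum>c\<in>S. eval_fps (bessel_fps c) t * z powi c)"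
    by (intro sums_sum sums_mult2 bessel_fps_sums)
  have B: "(\<lambda>n. (z + 1 / z) ^ n / fact n * t ^ n) sums exp (t * (z + 1 / z))"
  proof -
    have "(\<lambda>n. (z + 1 / z) ^ n / fact n * t ^ n) = (\<lambda>n. (t * (z + 1 / z)) ^ n /\<^sub>R fact n)"
      unfolding power_mult_distrib by (simp add: divide_inverse mult_ac)
    then show ?thesis using exp_converges[of "t * (z + 1 / z)"] by simp
  qed
  have C: "(\<Sum>c\<in>S. (bessel_fps c $ n * t ^ n) * z powi c) \<le> (z + 1 / z) ^ n / fact n * t ^ n" for n
  proof -
    have "(\<Sum>c\<in>S. (bessel_fps c $ n * t ^ n) * z powi c) = (\<Sum>c\<in>S. bessel_fps c $ n * z powi c) * t ^ n"
      by (subst sum_distrib_right) (simp add: mult_ac)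
    also have "\<dots> \<le> (z + 1 / z) ^ n / fact n * t ^ n"
      using assms by (intro mult_right_mono bessel_fps_nth_mgf_le) auto
    finally show ?thesis .
  qed
  have "(\<Sum>c\<in>S. heat t c * z powi c) = exp (- 2 * t) * (\<Sum>c\<in>S. eval_fps (bessel_fps c) t * z powi c)"
    by (simp add: heat_def sum_distrib_left mult.assoc)
  also have "\<dots> \<le> exp (- 2 * t) * exp (t * (z + 1 / z))"
    using sums_le[OF C A B] by simp
  also have "\<dots> = exp (t * (z + 1 / z - 2))"
    unfolding exp_add[symmetric] by (simp add: algebra_simps)
  finally show ?thesis .
qed

text \<open>The half of mass conservation used for lower bounds on the kernel, phrased through
  finite sums only: no uniform bound on the partial masses can be smaller than 1.\<close>

lemma heat_total_ge:
  assumes "t \<ge> 0" and bound: "\<And>N. (\<Sum>c\<in>{- int N..int N}. heat t c) \<le> B"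
  shows "1 \<le> B"
proof -
  have "(\<lambda>n. 2 ^ n / fact n * t ^ n) sums exp (2 * t)"
    using exp_converges[of "2 * t"] by (simp add: scaleR_conv_of_real field_simps power_mult_distrib)
  then have "(\<lambda>N. \<Sum>n<N. 2 ^ n / fact n * t ^ n) \<longlonglongrightarrow> exp (2 * t)"
    by (simp add: sums_def)
  moreover have "(\<Sum>n<N. 2 ^ n / fact n * t ^ n) \<le> exp (2 * t) * B" for N
  proof -
    \<comment> \<open>Paths with fewer than \<open>N\<close> steps stay in the window, so the first
      \<open>N\<close> coefficients lose no mass when \<open>c\<close> is restricted to it.\<close>
    have "(\<Sum>n<N. 2 ^ n / fact n * t ^ n) = (\<Sum>n<N. \<Sum>c\<in>{- int N..int N}. bessel_fps c $ n * t ^ n)"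
      by (intro sum.cong refl) (subst sum_distrib_right[symmetric], subst bessel_fps_nth_total, auto)
    also have "\<dots> = (\<Sum>c\<in>{- int N..int N}. \<Sum>n<N. bessel_fps c $ n * t ^ n)"
      by (rule sum.swap)
    also have "\<dots> \<le> (\<Sum>c\<in>{- int N..int N}. eval_fps (bessel_fps c) t)"
      unfolding sums_unique[OF bessel_fps_sums]
      using assms(1) by (intro sum_mono sum_le_suminf sums_summable[OF bessel_fps_sums]) (auto simp: bessel_fps_nth_nonneg)
    also have "\<dots> = exp (2 * t) * (\<Sum>c\<in>{- int N..int N}. heat t c)"
      by (simp add: heat_def sum_distrib_left mult.assoc[symmetric] exp_add[symmetric])
    also have "\<dots> \<le> exp (2 * t) * B" using bound by simp
    finally show ?thesis .
  qed
  ultimately have "exp (2 * t) \<le> exp (2 * t) * B"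
    by (blast intro: LIMSEQ_le_const2)
  then show ?thesis by simp
qed

section \<open>Size and decay of the free kernel on the diffusive scale\<close>

lemma exp_plus_exp_minus_le:
  fixes l :: real
  assumes "0 \<le> l" "l \<le> 1"
  shows "exp l + exp (- l) - 2 \<le> 2 * l\<^sup>2"
proof -
  have "exp l \<le> 1 + l + l\<^sup>2" using assms by (rule exp_bound)
  moreover have "exp (- l) \<le> 1 - l + l\<^sup>2"
  proof -
    \<comment> \<open>The product is \<open>1 + l ^ 3\<close>.\<close>
    have "1 \<le> (1 - l + l\<^sup>2) * (1 + l)"
      using assms by (simp add: algebra_simps power2_eq_square)
    also have "\<dots> \<le> (1 - l + l\<^sup>2) * exp l"
      using assms by (intro mult_left_mono) auto
    finally show ?thesis by (simp add: exp_minus field_simps)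
  qed
  ultimately show ?thesis by simp
qed

text \<open>The slope is the inverse diffusive length, so the exponent
  \<open>t * (exp s + exp (- s) - 2)\<close>, of order \<open>t * s ^ 2\<close>, stays bounded.
  Taking \<open>max 1 t\<close> keeps the slope at most 1 for short times, where the quadratic bound
  on the exponentials would otherwise fail. Either sign of \<open>s\<close> is allowed, so both
  tails are controlled.\<close>

lemma heat_exp_moment_le:
  assumes "finite S" "t \<ge> 0" and s: "\<bar>s\<bar> = 1 / sqrt (max 1 t)"
  shows "(\<Sum>c\<in>S. heat t c * exp (of_int c * s)) \<le> exp 2"
proof -
  define l where "l = 1 / sqrt (max 1 t)"
  have l: "0 \<le> l" "l \<le> 1" "max 1 t * l\<^sup>2 = 1"
    by (auto simp: l_def power_divide)
  have "(\<Sum>c\<in>S. heat t c * exp (of_int c * s)) = (\<Sum>c\<in>S. heat t c * exp s powi c)"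
    by (simp add: exp_power_int)
  also have "\<dots> \<le> exp (t * (exp s + 1 / exp s - 2))"
    using assms by (intro heat_mgf_le) auto
  also have "exp s + 1 / exp s - 2 = exp l + exp (- l) - 2"
    using s by (auto simp: l_def[symmetric] abs_if exp_minus field_simps split: if_splits)
  also have "t * (exp l + exp (- l) - 2) \<le> max 1 t * (exp l + exp (- l) - 2)"
  proof (rule mult_right_mono)
    have "2 \<le> exp l + exp (- l)"
      using exp_ge_add_one_self[of l] exp_ge_add_one_self[of "- l"] by linarith
    then show "0 \<le> exp l + exp (- l) - 2" by simp
  qed simp
  also have "\<dots> \<le> max 1 t * (2 * l\<^sup>2)"
    using l by (intro mult_left_mono exp_plus_exp_minus_le) auto
  also have "\<dots> = 2" using l by simp
  finally show ?thesis by simp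
qed

lemma heat_0_le:
  assumes "t \<ge> 0"
  shows "heat t 0 \<le> exp 2 / sqrt (max 1 t)"
proof (cases "t \<le> 1")
  case True
  then show ?thesis using heat_exp_moment_le[of "{0}" t 1] assms by (simp add: max_absorb1)
next
  case False
  then have t: "t > 1" "max 1 t = t" by auto
  define l where "l = 1 / sqrt t"
  have l: "l > 0" using t by (simp add: l_def)
  have le: "t * (heat t 0 + heat t 1 - heat t (int N) - heat t (int N + 1)) \<le> exp 2 / l" for N
  proof -
    have "t * (heat t 0 + heat t 1 - heat t (int N) - heat t (int N + 1))
        = (\<Sum>c\<in>{1..int N}. of_int c * heat t c)"
    proof (induction N)
      case (Suc N)
      have "{1..int (Suc N)} = insert (int N + 1) {1..int N}" by auto
      then have "(\<Sum>c\<in>{1..int (Suc N)}. of_int c * heat t c)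
          = of_int (int N + 1) * heat t (int N + 1) + (\<Sum>c\<in>{1..int N}. of_int c * heat t c)"
        by simp
      also have "\<dots> = t * (heat t (int N) - heat t (int N + 2)) +
          t * (heat t 0 + heat t 1 - heat t (int N) - heat t (int N + 1))"
      proof -
        have "int N + 1 - 1 = int N" "int N + 1 + 1 = int N + 2" by auto
        then show ?thesis using heat_rec[of "int N + 1" t] Suc.IH by (simp only:)
      qed
      finally show ?case by (simp add: algebra_simps)
    qed simp
    \<comment> \<open>The first moment is traded for the exponential moment; the price
      \<open>1 / l = sqrt t\<close> is what leaves \<open>t * heat t 0\<close> of order
      \<open>sqrt t\<close>.\<close>
    also have "\<dots> \<le> (\<Sum>c\<in>{1..int N}. (1 / l) * (heat t c * exp (of_int c * l)))"
    proof (rule sum_mono)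
      fix c assume "c \<in> {1..int N}"
      have "of_int c * l \<le> exp (of_int c * l)"
        using exp_ge_add_one_self[of "of_int c * l"] by linarith
      then have "heat t c * (of_int c * l) \<le> heat t c * exp (of_int c * l)"
        using assms by (intro mult_left_mono heat_nonneg)
      then show "of_int c * heat t c \<le> (1 / l) * (heat t c * exp (of_int c * l))"
        using l by (simp add: field_simps)
    qed
    also have "\<dots> = (1 / l) * (\<Sum>c\<in>{1..int N}. heat t c * exp (of_int c * l))"
      by (simp only: sum_distrib_left)
    also have "\<dots> \<le> (1 / l) * exp 2"
      using t l by (intro mult_left_mono heat_exp_moment_le) (auto simp: l_def)
    finally show ?thesis by simp
  qed
  \<comment> \<open>The boundary terms of the telescoping sum must vanish. One term of the
    exponential moment already gives geometric decay.\<close>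
  have lim: "(\<lambda>N. heat t (int N)) \<longlonglongrightarrow> 0"
  proof (rule tendsto_sandwich[of "\<lambda>_. 0"])
    have "heat t (int N) \<le> exp 2 * exp (- l) ^ N" for N
      using heat_exp_moment_le[of "{int N}" t l] t l
      by (simp add: l_def[symmetric] exp_of_nat_mult[symmetric] exp_minus field_simps)
    then show "eventually (\<lambda>N. heat t (int N) \<le> exp 2 * exp (- l) ^ N) sequentially" by simp
    have "(\<lambda>N. exp 2 * exp (- l) ^ N) \<longlonglongrightarrow> exp 2 * 0"
      using l by (intro tendsto_intros LIMSEQ_power_zero) simp
    then show "(\<lambda>N. exp 2 * exp (- l) ^ N) \<longlonglongrightarrow> 0" by simp
  qed (use assms heat_nonneg in auto)
  have lim': "(\<lambda>N. heat t (int N + 1)) \<longlonglongrightarrow> 0"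
    using LIMSEQ_Suc[OF lim] by (simp add: add.commute)
  have "(\<lambda>N. t * (heat t 0 + heat t 1 - heat t (int N) - heat t (int N + 1))) \<longlonglongrightarrow> t * (heat t 0 + heat t 1 - 0 - 0)"
    by (intro tendsto_intros lim lim')
  then have "t * (heat t 0 + heat t 1 - 0 - 0) \<le> exp 2 / l"
    by (rule LIMSEQ_le_const2) (use le in blast)
  moreover have "t * heat t 0 \<le> t * (heat t 0 + heat t 1)"
    using heat_nonneg[OF assms, of 1] assms by (intro mult_left_mono) auto
  ultimately have "t * heat t 0 \<le> exp 2 / l" by simp
  also have "\<dots> = t * (exp 2 / sqrt t)"
    using t by (simp add: l_def field_simps)
  finally show ?thesis using t by (simp del: times_divide_eq_right)
qed

text \<open>The exponential moment at a single point gives the decay but not the prefactor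
  \<open>1 / sqrt t\<close>. The prefactor is recovered by averaging: by monotonicity the value at
  \<open>n\<close> is at most every value on the upper half of \<open>{0..n}\<close>, which has at
  least \<open>n / 2\<close> points. Exponential weights there are only guaranteed to be those of
  \<open>n / 2\<close>, hence the factor 2 in the rate. When \<open>n\<close> is at most two
  diffusive lengths the decay factor is at least \<open>exp (- 1)\<close>, which turns
  \<open>exp 2\<close> into \<open>exp 3\<close>.\<close>

lemma heat_le:
  assumes "t \<ge> 0"
  shows "heat t c \<le> exp 3 / sqrt (max 1 t) * exp (- of_int \<bar>c\<bar> / (2 * sqrt (max 1 t)))"
proof -
  define r where "r = sqrt (max 1 t)"
  define n where "n = \<bar>c\<bar>"
  have r: "r \<ge> 1" by (simp add: r_def)
  have "heat t n \<le> exp 3 / r * exp (- of_int n / (2 * r))"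
  proof (cases "of_int n \<le> 2 * r")
    case True
    have "heat t n \<le> heat t 0" using assms by (intro heat_mono) auto
    also have "\<dots> \<le> exp 2 / r" using heat_0_le[OF assms] by (simp add: r_def)
    also have "\<dots> = exp 3 / r * exp (- 1)"
      by (simp add: exp_add[symmetric])
    also have "\<dots> \<le> exp 3 / r * exp (- of_int n / (2 * r))"
      using r True by (intro mult_left_mono) (auto simp: field_simps)
    finally show ?thesis .
  next
    case False
    define m where "m = n div 2"
    have m: "0 \<le> m" "m \<le> n" "n \<le> 2 * (m + 1)" "n \<le> 2 * (n - m)" by (auto simp: m_def n_def)
    have "of_int n / 2 * (heat t n * exp (of_int n / (2 * r)))
        \<le> of_nat (card {n - m..n}) * (heat t n * exp (of_int n / (2 * r)))"
      using m by (intro mult_right_mono mult_nonneg_nonneg heat_nonneg assms) auto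
    also have "\<dots> = (\<Sum>c\<in>{n - m..n}. heat t n * exp (of_int n / (2 * r)))"
      by simp
    also have "\<dots> \<le> (\<Sum>c\<in>{n - m..n}. heat t c * exp (of_int c * (1 / r)))"
    proof (intro sum_mono mult_mono)
      fix c assume c: "c \<in> {n - m..n}"
      then show "heat t n \<le> heat t c" using m assms by (intro heat_mono) auto
      have "n \<le> 2 * c" using c m by auto
      then have "(of_int n :: real) \<le> 2 * of_int c" by linarith
      then show "exp (of_int n / (2 * r)) \<le> exp (of_int c * (1 / r))"
        using r by (simp add: field_simps)
    qed (use assms heat_nonneg in auto)
    also have "\<dots> \<le> exp 2"
      using assms by (intro heat_exp_moment_le) (auto simp: r_def)
    finally have *: "of_int n / 2 * (heat t n * exp (of_int n / (2 * r))) \<le> exp 2" .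
    have "r * (heat t n * exp (of_int n / (2 * r))) \<le> of_int n / 2 * (heat t n * exp (of_int n / (2 * r)))"
      using False assms by (intro mult_right_mono mult_nonneg_nonneg heat_nonneg) auto
    also note *
    also have "exp 2 \<le> (exp 3 :: real)" by simp
    finally show ?thesis using r by (simp add: exp_minus field_simps)
  qed
  then show ?thesis by (simp add: n_def r_def heat_abs)
qed

lemma heat_0_ge:
  assumes "t \<ge> 1"
  shows "heat t 0 \<ge> 1 / (18 * sqrt t)"
proof -
  define l where "l = 1 / sqrt t"
  \<comment> \<open>Outside a window of radius \<open>4 * sqrt t\<close> the exponential moments
    leave mass at most \<open>exp (- 4) * 2 * exp 2\<close>, which is at most \<open>1 / 2\<close>.
    The window has at most \<open>9 * sqrt t\<close> points, none with a larger value than 0; this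
    produces the constant 18.\<close>
  define L where "L = \<lfloor>4 * sqrt t\<rfloor>"
  have rt: "sqrt t \<ge> 1" using assms by simp
  have l: "l > 0" "\<bar>l\<bar> = 1 / sqrt (max 1 t)" "\<bar>- l\<bar> = 1 / sqrt (max 1 t)"
    using assms by (auto simp: l_def max_def)
  have e4: "exp (-4) * (2 * exp 2) \<le> (1 / 2 :: real)"
  proof -
    have "exp (1::real) \<ge> 2" using exp_ge_add_one_self[of 1] by simp
    then have "exp (1::real) ^ 2 \<ge> 2 ^ 2" by (intro power_mono) auto
    then have "exp (2::real) \<ge> 4" by (simp add: exp_of_nat_mult[symmetric])
    then have "2 * exp (-2) \<le> (1 / 2 :: real)" by (simp add: exp_minus field_simps)
    moreover have "exp (-4) * (2 * exp 2) = 2 * (exp (-2) :: real)"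
      by (simp add: exp_add[symmetric])
    ultimately show ?thesis by (simp only:)
  qed
  have L0: "0 \<le> L" using rt by (simp add: L_def)
  have Lr: "of_int L \<le> 4 * sqrt t" by (simp add: L_def)
  have "1 \<le> 9 * sqrt t * heat t 0 + 1 / 2"
  proof (rule heat_total_ge)
    fix N
    let ?A = "{- int N..int N}"
    have "(\<Sum>c\<in>?A. heat t c) \<le> (\<Sum>c\<in>?A. (if c \<in> {-L..L} then heat t 0 else 0) +
        exp (-4) * (heat t c * exp (of_int c * l) + heat t c * exp (of_int c * (- l))))"
    proof (rule sum_mono)
      fix c
      have h: "heat t c \<ge> 0" using assms by (intro heat_nonneg) auto
      show "heat t c \<le> (if c \<in> {-L..L} then heat t 0 else 0) +
        exp (-4) * (heat t c * exp (of_int c * l) + heat t c * exp (of_int c * (- l)))"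
      proof (cases "c \<in> {-L..L}")
        case True
        have "heat t c \<le> heat t 0" using assms by (intro heat_mono) auto
        moreover have "0 \<le> exp (-4) * (heat t c * exp (of_int c * l) + heat t c * exp (of_int c * (- l)))"
          using h by simp
        ultimately show ?thesis using True by simp
      next
        case False
        then have "\<bar>c\<bar> > L" by auto
        then have "4 * sqrt t < of_int \<bar>c\<bar>" by (simp add: L_def floor_less_iff)
        then have "4 \<le> of_int \<bar>c\<bar> * l" using rt by (simp add: l_def field_simps)
        then have "exp 4 \<le> exp (of_int \<bar>c\<bar> * l)" by simp
        also have "\<dots> \<le> exp (of_int c * l) + exp (of_int c * (- l))"
          by (cases "c \<ge> 0") auto
        finally have "exp (-4) * (heat t c * exp 4) \<le>
            exp (-4) * (heat t c * (exp (of_int c * l) + exp (of_int c * (- l))))"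
          using h by (intro mult_left_mono) auto
        moreover have "exp (-4) * (heat t c * exp 4) = heat t c" by (simp add: exp_minus)
        ultimately show ?thesis unfolding if_not_P[OF False] by (simp only: distrib_left add_0)
      qed
    qed
    also have "\<dots> = (\<Sum>c\<in>?A \<inter> {-L..L}. heat t 0) + exp (-4) *
        ((\<Sum>c\<in>?A. heat t c * exp (of_int c * l)) + (\<Sum>c\<in>?A. heat t c * exp (of_int c * (- l))))"
      unfolding sum.distrib sum_distrib_left[symmetric]
      by (simp only: sum.inter_restrict[OF finite_atLeastAtMost_int])
    also have "\<dots> \<le> (\<Sum>c\<in>{-L..L}. heat t 0) + exp (-4) * (exp 2 + exp 2)"
      using assms l by (intro add_mono mult_left_mono heat_exp_moment_le sum_mono2 heat_nonneg) auto
    also have "(\<Sum>c\<in>{-L..L}. heat t 0) = (2 * of_int L + 1) * heat t 0"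
      using L0 by simp
    also have "\<dots> \<le> (9 * sqrt t) * heat t 0"
    proof (intro mult_right_mono heat_nonneg)
      show "2 * of_int L + 1 \<le> 9 * sqrt t" using Lr rt by linarith
    qed (use assms in simp)
    also have "exp (-4) * (exp 2 + exp 2) \<le> (1 / 2 :: real)" using e4 by simp
    finally show "(\<Sum>c\<in>?A. heat t c) \<le> 9 * sqrt t * heat t 0 + 1 / 2" by simp
  qed (use assms in simp)
  then show ?thesis using rt by (simp add: field_simps)
qed

text \<open>Near the origin the kernel is almost flat. The recurrence gives each drop from
  \<open>2 * j\<close> to \<open>2 * j + 2\<close> as \<open>(2 * j + 1) / t\<close> times a kernel
  value, and these odd numbers add up to a square, so only a fraction \<open>j ^ 2 / t\<close> of
  \<open>heat t 0\<close> is lost. A loss of at most a quarter turns 18 into 24.\<close>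

lemma heat_ge:
  assumes "of_int \<bar>c\<bar> + 1 \<le> sqrt t"
  shows "heat t c \<ge> 1 / (24 * sqrt t)"
proof -
  have rt: "sqrt t \<ge> 1" using assms by linarith
  then have t: "t \<ge> 1" by simp
  have even: "heat t 0 - heat t (2 * int j) \<le> heat t 0 * (real j ^ 2 / t)" for j
  proof (induction j)
    case (Suc j)
    have "heat t (2 * int j) - heat t (2 * int j + 2) = (2 * real j + 1) / t * heat t (2 * int j + 1)"
      using heat_rec[of "2 * int j + 1" t] t by (simp add: field_simps)
    also have "\<dots> \<le> (2 * real j + 1) / t * heat t 0"
      using t by (intro mult_left_mono heat_mono) auto
    finally have "heat t 0 - heat t (2 * int (Suc j)) \<le> heat t 0 * (real j ^ 2 / t) + (2 * real j + 1) / t * heat t 0"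
      using Suc.IH by (simp add: algebra_simps)
    also have "\<dots> = heat t 0 * (real (Suc j) ^ 2 / t)"
      using t by (simp add: field_simps power2_eq_square)
    finally show ?case .
  qed simp
  \<comment> \<open>The recurrence links only sites of equal parity, so \<open>\<bar>c\<bar>\<close>
    is rounded up to an even number; monotonicity covers the rounding, and the \<open>+ 1\<close> in
    the hypothesis pays for it.\<close>
  define j where "j = nat ((\<bar>c\<bar> + 1) div 2)"
  have j: "\<bar>c\<bar> \<le> 2 * int j" "2 * int j \<le> \<bar>c\<bar> + 1" by (auto simp: j_def)
  have "2 * real j \<le> of_int \<bar>c\<bar> + 1" using j(2) by linarith
  then have "2 * real j \<le> sqrt t" using assms by linarith
  then have "(2 * real j)\<^sup>2 \<le> (sqrt t)\<^sup>2" by (intro power_mono) auto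
  then have "real j ^ 2 / t \<le> 1 / 4" using t by (simp add: power_mult_distrib field_simps)
  then have "heat t 0 * (real j ^ 2 / t) \<le> heat t 0 * (1 / 4)"
    using t by (intro mult_left_mono heat_nonneg) auto
  then have "3 / 4 * heat t 0 \<le> heat t (2 * int j)" using even[of j] by linarith
  also have "\<dots> \<le> heat t c" using j t by (intro heat_mono) auto
  finally have "3 / 4 * heat t 0 \<le> heat t c" .
  moreover have "3 / 4 * (1 / (18 * sqrt t)) \<le> 3 / 4 * heat t 0"
    using heat_0_ge[OF t] by (intro mult_left_mono) auto
  ultimately show ?thesis by simp
qed

section \<open>The kernel killed at the origin\<close>

definition killed_heat :: "real \<Rightarrow> int \<Rightarrow> int \<Rightarrow> real" where
  "killed_heat t a b = heat t (a - b) - heat t (a + b)"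

lemma killed_heat_commute: "killed_heat t a b = killed_heat t b a"
  unfolding killed_heat_def by (metis heat_minus minus_diff_eq add.commute)

lemma killed_heat_nonneg: "a \<ge> 1 \<Longrightarrow> b \<ge> 1 \<Longrightarrow> t \<ge> 0 \<Longrightarrow> killed_heat t a b \<ge> 0"
  unfolding killed_heat_def using heat_mono[of "a - b" "a + b" t] by simp

text \<open>The Bessel recurrence turns the difference given by the reflection principle into a
  telescoping sum of positive terms; both bounds on the killed kernel are read off from it.\<close>

lemma killed_heat_eq_sum:
  assumes "t > 0"
  shows "killed_heat t a (int n) = (\<Sum>j<n. of_int (a - int n + 1 + 2 * int j) / t * heat t (a - int n + 1 + 2 * int j))"
proof -
  have "of_int (a - int n + 1 + 2 * int j) / t * heat t (a - int n + 1 + 2 * int j)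
      = heat t (a - int n + 2 * int j) - heat t (a - int n + 2 * int (Suc j))" for j
    using heat_rec[of "a - int n + 1 + 2 * int j" t] assms by (simp add: field_simps)
  then have "(\<Sum>j<n. of_int (a - int n + 1 + 2 * int j) / t * heat t (a - int n + 1 + 2 * int j))
      = (\<Sum>j<n. heat t (a - int n + 2 * int j) - heat t (a - int n + 2 * int (Suc j)))"
    by (intro sum.cong refl)
  also have "\<dots> = killed_heat t a (int n)"
    by (subst sum_lessThan_telescope') (simp add: killed_heat_def add.commute)
  finally show ?thesis by simp
qed

lemma sum_odd_progression: "(\<Sum>j<n. s + 1 + 2 * real j) = real n * (s + real n)"
proof (induction n)
  case (Suc n)
  then show ?case by (simp only: sum.lessThan_Suc) (simp add: algebra_simps)
qed simp

lemma killed_heat_le: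
  assumes "a \<ge> 1" "b \<ge> 1" "t \<ge> 0"
  shows "killed_heat t a b \<le> min 1 (of_int (a * b) / max 1 t) * heat t (a - b)"
proof -
  have le1: "killed_heat t a b \<le> heat t (a - b)"
    unfolding killed_heat_def using heat_nonneg[OF assms(3)] by simp
  have le2: "killed_heat t a b \<le> of_int (a * b) / t * heat t (a - b)" if "1 \<le> b" "b \<le> a" "t > 0" for a b
  proof -
    define n where "n = nat b"
    have b: "b = int n" using that by (simp add: n_def)
    \<comment> \<open>All sites in the telescoped sum lie farther from 0 than \<open>a - b\<close>,
      so each kernel value is at most \<open>heat t (a - b)\<close>.\<close>
    have "killed_heat t a b \<le> (\<Sum>j<n. of_int (a - int n + 1 + 2 * int j) / t * heat t (a - b))"
      unfolding b killed_heat_eq_sum[OF \<open>t > 0\<close>]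
      using that b by (intro sum_mono mult_left_mono heat_mono divide_nonneg_pos) auto
    also have "\<dots> = (\<Sum>j<n. of_int (a - int n) + 1 + 2 * real j) / t * heat t (a - b)"
      by (simp add: sum_distrib_right sum_divide_distrib)
    also have "\<dots> = of_int (a * b) / t * heat t (a - b)"
      unfolding sum_odd_progression b by (simp add: mult.commute)
    finally show ?thesis .
  qed
  show ?thesis
  proof (cases "t \<le> 1 \<or> of_int (a * b) / max 1 t \<ge> 1")
    case True
    have "1 \<le> a * b" using assms mult_mono[of 1 a 1 b] by simp
    then have "1 \<le> (of_int (a * b) :: real)" by linarith
    then have "min 1 (of_int (a * b) / max 1 t) = 1" using True by (auto simp: max_def)
    then show ?thesis using le1 by (simp only: mult_1)
  next
    case False
    then have "min 1 (of_int (a * b) / max 1 t) = of_int (a * b) / t" by (auto simp: max_def)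
    moreover have "killed_heat t a b \<le> of_int (a * b) / t * heat t (a - b)"
      using le2[of a b] le2[of b a] assms False killed_heat_commute[of t a b] heat_minus[of t "a - b"]
      by (cases "b \<le> a") (auto simp: mult.commute)
    ultimately show ?thesis by simp
  qed
qed

lemma killed_heat_ge:
  assumes "a \<ge> 1" "b \<ge> 1" "64 * (1 + of_int \<bar>a - b\<bar>)\<^sup>2 \<le> t"
  shows "killed_heat t a b \<ge> min 1 (of_int (a * b) / t) / (6144 * sqrt t)"
proof -
  have main: "killed_heat t a b \<ge> min 1 (of_int (a * b) / t) / (6144 * sqrt t)"
    if "1 \<le> b" "b \<le> a" "64 * (1 + of_int (a - b))\<^sup>2 \<le> t" for a b
  proof -
    define n where "n = nat b"
    have b: "b = int n" using that by (simp add: n_def)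
    define s where "s = (of_int (a - b) :: real)"
    have s: "s \<ge> 0" using that by (simp add: s_def)
    have "sqrt ((8 * (1 + s))\<^sup>2) \<le> sqrt t"
      using that(3) unfolding power_mult_distrib s_def by (intro real_sqrt_le_mono) simp
    then have rt: "8 + 8 * s \<le> sqrt t" using s by simp
    then have rt8: "sqrt t \<ge> 8" using s by linarith
    then have t: "t > 0" using real_sqrt_gt_0_iff[of t] by linarith
    \<comment> \<open>The sum is cut after about \<open>sqrt t / 8\<close> terms so that its sites
      stay within the range of \<open>heat_ge\<close>; the factor 64 in the hypothesis makes
      \<open>sqrt t\<close> at least eight times \<open>1 + s\<close>. If nothing is cut, the
      weights add up to \<open>a * b\<close>. Otherwise they add up to at least
      \<open>m ^ 2 \<ge> t / 256\<close>, and \<open>6144 = 24 * 256\<close>.\<close>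
    define m where "m = nat \<lfloor>sqrt t / 8\<rfloor>"
    have m: "real m \<le> sqrt t / 8" "real m \<ge> sqrt t / 16"
    proof -
      have fl: "1 \<le> \<lfloor>sqrt t / 8\<rfloor>" using rt8 by (simp add: le_floor_iff)
      then have eq: "real m = of_int \<lfloor>sqrt t / 8\<rfloor>" unfolding m_def by linarith
      then show "real m \<le> sqrt t / 8" by linarith
      have "real m \<ge> 1" "real m > sqrt t / 8 - 1" using fl eq by linarith+
      then show "real m \<ge> sqrt t / 16" by linarith
    qed
    define n' where "n' = min n m"
    have "min 1 (of_int (a * b) / t) / (6144 * sqrt t) \<le> real n' * (s + real n') / (t * (24 * sqrt t))"
    proof (cases "n \<le> m")
      case True
      then have "real n' * (s + real n') = of_int (a * b)"
        by (simp add: n'_def s_def b mult.commute)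
      moreover have "min 1 (of_int (a * b) / t) / (6144 * sqrt t) \<le> of_int (a * b) / t / (24 * sqrt t)"
      proof (rule frac_le)
        show "0 \<le> of_int (a * b) / t" using that t by (intro divide_nonneg_pos) auto
      qed (use rt8 t in auto)
      ultimately show ?thesis by (simp only: divide_divide_eq_left)
    next
      case False
      have "t / 256 = (sqrt t / 16)\<^sup>2" using t by (simp add: power_divide)
      also have "\<dots> \<le> (real m)\<^sup>2" using m rt8 t by (intro power_mono) auto
      also have "\<dots> \<le> real n' * (s + real n')"
        using s False by (simp add: n'_def power2_eq_square mult_left_mono)
      finally have "t / 256 / (t * (24 * sqrt t)) \<le> real n' * (s + real n') / (t * (24 * sqrt t))"
        using t by (intro divide_right_mono) auto
      moreover have "t / 256 / (t * (24 * sqrt t)) = 1 / (6144 * sqrt t)" using t by simp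
      moreover have "min 1 (of_int (a * b) / t) / (6144 * sqrt t) \<le> 1 / (6144 * sqrt t)"
        using t by (intro divide_right_mono) auto
      ultimately show ?thesis by linarith
    qed
    also have "\<dots> = (\<Sum>j<n'. (s + 1 + 2 * real j) / t * (1 / (24 * sqrt t)))"
      unfolding sum_odd_progression[symmetric] by (simp add: sum_divide_distrib)
    also have "\<dots> \<le> (\<Sum>j<n'. of_int (a - int n + 1 + 2 * int j) / t * heat t (a - int n + 1 + 2 * int j))"
    proof (intro sum_mono mult_mono heat_ge)
      fix j assume "j \<in> {..<n'}"
      then have "j < m" by (simp add: n'_def)
      then have "real j + 1 \<le> real m" by linarith
      then have "s + 1 + 2 * real j + 1 \<le> sqrt t" using m rt by linarith
      moreover have "\<bar>a - int n + 1 + 2 * int j\<bar> = a - int n + 1 + 2 * int j" using that b by simp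
      ultimately show "of_int \<bar>a - int n + 1 + 2 * int j\<bar> + 1 \<le> sqrt t" by (simp add: s_def b)
    qed (use that b t in \<open>auto simp: s_def\<close>)
    also have "\<dots> \<le> (\<Sum>j<n. of_int (a - int n + 1 + 2 * int j) / t * heat t (a - int n + 1 + 2 * int j))"
      using that b t by (intro sum_mono2 mult_nonneg_nonneg heat_nonneg) (auto simp: n'_def)
    also have "\<dots> = killed_heat t a b" unfolding b killed_heat_eq_sum[OF t] ..
    finally show ?thesis .
  qed
  show ?thesis
    using main[of b a] main[of a b] assms killed_heat_commute[of t a b]
    by (cases "b \<le> a") (auto simp: mult.commute)
qed

section \<open>Poissonization\<close>

lemma fps_deriv_prod:
  fixes f :: "'b \<Rightarrow> 'a::comm_ring_1 fps"
  assumes "finite I"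
  shows "fps_deriv (\<Prod>i\<in>I. f i) = (\<Sum>i\<in>I. fps_deriv (f i) * (\<Prod>j\<in>I - {i}. f j))"
  using assms
proof (induction I)
  case (insert a I)
  have "f a * (\<Sum>i\<in>I. fps_deriv (f i) * (\<Prod>j\<in>I - {i}. f j))
      = (\<Sum>i\<in>I. fps_deriv (f i) * (\<Prod>j\<in>insert a I - {i}. f j))"
    unfolding sum_distrib_left
  proof (rule sum.cong)
    fix i assume "i \<in> I"
    then have "insert a I - {i} = insert a (I - {i})" using insert.hyps by auto
    then show "f a * (fps_deriv (f i) * (\<Prod>j\<in>I - {i}. f j)) = fps_deriv (f i) * (\<Prod>j\<in>insert a I - {i}. f j)"
      using insert.hyps by (simp add: mult_ac)
  qed simp
  then show ?case using insert by (simp add: algebra_simps)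
qed simp

lemma fps_prod_nth_0: "(\<Prod>i\<in>I. f i) $ 0 = (\<Prod>i\<in>I. f i $ 0)"
  for f :: "'b \<Rightarrow> 'a::comm_ring_1 fps"
  by (induction I rule: infinite_finite_induct) (simp_all add: fps_mult_nth_0)

definition coord_fps :: "nat \<Rightarrow> nat \<Rightarrow> int \<Rightarrow> int \<Rightarrow> real fps" where
  "coord_fps k i a b = (if i < k then bessel_fps (a - b) - bessel_fps (a + b) else bessel_fps (a - b))"

definition coord_kernel :: "nat \<Rightarrow> nat \<Rightarrow> real \<Rightarrow> int \<Rightarrow> int \<Rightarrow> real" where
  "coord_kernel k i t a b = (if i < k then killed_heat t a b else heat t (a - b))"

lemma coord_fps_deriv:
  "fps_deriv (coord_fps k i a b) = coord_fps k i (a + 1) b + coord_fps k i (a - 1) b"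
  by (simp add: coord_fps_def bessel_fps_deriv algebra_simps)

lemma coord_fps_nth_0:
  assumes "i < k \<Longrightarrow> a \<ge> 0 \<and> b \<ge> 1"
  shows "coord_fps k i a b $ 0 = (if a = b then 1 else 0)"
  using assms by (auto simp: coord_fps_def bessel_fps_nth_0)

lemma coord_fps_0: "i < k \<Longrightarrow> coord_fps k i 0 b = 0"
  by (simp add: coord_fps_def bessel_fps_minus)

lemma coord_fps_conv_radius: "fps_conv_radius (coord_fps k i a b) = \<infinity>"
  using fps_conv_radius_diff[of "bessel_fps (a - b)" "bessel_fps (a + b)"] by (simp add: coord_fps_def)

lemma coord_kernel_eq: "coord_kernel k i t a b = exp (- 2 * t) * eval_fps (coord_fps k i a b) t"
  by (simp add: coord_kernel_def coord_fps_def killed_heat_def heat_def eval_fps_diff algebra_simps)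

lemma coord_kernel_nonneg:
  assumes "i < k \<Longrightarrow> a \<ge> 1 \<and> b \<ge> 1" "t \<ge> 0"
  shows "coord_kernel k i t a b \<ge> 0"
  using assms by (auto simp: coord_kernel_def killed_heat_nonneg heat_nonneg)

text \<open>The exponential generating function of the numbers of paths killed on leaving the
  orthant, when \<open>x\<close> and \<open>y\<close> lie in it.\<close>

definition walk_fps :: "nat \<Rightarrow> nat \<Rightarrow> (nat \<Rightarrow> int) \<Rightarrow> (nat \<Rightarrow> int) \<Rightarrow> real fps" where
  "walk_fps d k x y = (\<Prod>i<d. coord_fps k i (x i) (y i))"

text \<open>By the Leibniz rule one coordinate moves at a time, so differentiation reproduces the
  one-step recursion of \<open>killed_prob\<close> up to its normalisation and its test for
  membership in the set.\<close>

lemma walk_fps_deriv: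
  "fps_deriv (walk_fps d k x y) =
     (\<Sum>i<d. walk_fps d k (x(i := x i + 1)) y + walk_fps d k (x(i := x i - 1)) y)"
proof -
  have upd: "walk_fps d k (x(i := a)) y =
      coord_fps k i a (y i) * (\<Prod>j\<in>{..<d} - {i}. coord_fps k j (x j) (y j))" if "i < d" for i a
  proof -
    have "walk_fps d k (x(i := a)) y = coord_fps k i a (y i) *
        (\<Prod>j\<in>{..<d} - {i}. coord_fps k j ((x(i := a)) j) (y j))"
      unfolding walk_fps_def using that by (subst prod.remove[of _ i]) auto
    also have "(\<Prod>j\<in>{..<d} - {i}. coord_fps k j ((x(i := a)) j) (y j))
        = (\<Prod>j\<in>{..<d} - {i}. coord_fps k j (x j) (y j))"
      by (intro prod.cong) auto
    finally show ?thesis .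
  qed
  have "fps_deriv (walk_fps d k x y) = (\<Sum>i<d. (coord_fps k i (x i + 1) (y i) + coord_fps k i (x i - 1) (y i)) *
      (\<Prod>j\<in>{..<d} - {i}. coord_fps k j (x j) (y j)))"
    unfolding walk_fps_def fps_deriv_prod[OF finite_lessThan] coord_fps_deriv ..
  also have "\<dots> = (\<Sum>i<d. walk_fps d k (x(i := x i + 1)) y + walk_fps d k (x(i := x i - 1)) y)"
    by (intro sum.cong refl) (simp only: upd distrib_right lessThan_iff)
  finally show ?thesis .
qed

text \<open>Points with a zero among the first $k$ coordinates have to be admitted, since they are
  reached in one step from the orthant; there the product vanishes.\<close>

lemma walk_fps_killed_prob:
  assumes "d > 0" "k \<le> d" "y \<in> orthant d k" "x \<in> lattice d" "\<And>i. i < k \<Longrightarrow> x i \<ge> 0"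
  shows "fact n * walk_fps d k x y $ n = (2 * real d) ^ n * killed_prob d (orthant d k) n x y"
  using assms(4,5)
proof (induction n arbitrary: x)
  case (0 x)
  have y: "y i \<ge> 1" if "i < k" for i using assms(3) that by (simp add: orthant_def)
  have "walk_fps d k x y $ 0 = (\<Prod>i<d. if x i = y i then 1 else 0)"
    unfolding walk_fps_def fps_prod_nth_0 using 0 y by (intro prod.cong refl coord_fps_nth_0) auto
  also have "\<dots> = (if x = y then 1 else 0)"
  proof (cases "x = y")
    case False
    then obtain i where i: "x i \<noteq> y i" by auto
    then have "i < d" using 0 assms(3) by (cases "i < d") (auto simp: lattice_def orthant_def)
    then have "(\<Prod>i<d. if x i = y i then 1 else (0::real)) = 0"
      using i by (intro prod_zero) auto
    then show ?thesis using False by simp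
  qed simp
  finally show ?case using assms(3) by auto
next
  case (Suc n x)
  show ?case
  proof (cases "x \<in> orthant d k")
    case False
    then obtain i where i: "i < k" "x i = 0" using Suc.prems by (force simp: orthant_def)
    then have "walk_fps d k x y = 0"
      unfolding walk_fps_def using coord_fps_0 assms(2) by (intro prod_zero) (auto intro!: bexI[of _ i])
    then show ?thesis using False by simp
  next
    case True
    have IH: "fact n * walk_fps d k (x(i := a)) y $ n =
        (2 * real d) ^ n * killed_prob d (orthant d k) n (x(i := a)) y" if "i < d" "a \<ge> x i - 1" for i a
    proof (rule Suc.IH)
      show "x(i := a) \<in> lattice d" using Suc.prems(1) that by (auto simp: lattice_def)
      show "0 \<le> (x(i := a)) j" if "j < k" for j
        using True that \<open>a \<ge> x i - 1\<close> by (force simp: orthant_def)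
    qed
    have "fact (Suc n) * walk_fps d k x y $ Suc n = fact n * fps_deriv (walk_fps d k x y) $ n"
      by simp
    also have "\<dots> = (\<Sum>i<d. fact n * walk_fps d k (x(i := x i + 1)) y $ n
        + fact n * walk_fps d k (x(i := x i - 1)) y $ n)"
      unfolding walk_fps_deriv by (simp add: fps_sum_nth sum_distrib_left distrib_left)
    also have "\<dots> = (2 * real d) ^ n * (\<Sum>i<d. killed_prob d (orthant d k) n (x(i := x i + 1)) y
        + killed_prob d (orthant d k) n (x(i := x i - 1)) y)"
      unfolding sum_distrib_left distrib_left by (intro sum.cong refl) (simp add: IH)
    also have "\<dots> = (2 * real d) ^ Suc n * killed_prob d (orthant d k) (Suc n) x y"
      using True assms(1) by simp
    finally show ?thesis .
  qed
qed

section \<open>From the series over steps to the integral over time\<close>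

lemma killed_prob_nonneg: "killed_prob d A n x y \<ge> 0"
  by (induction n arbitrary: x) (auto intro!: sum_nonneg divide_nonneg_nonneg)

definition product_kernel :: "nat \<Rightarrow> nat \<Rightarrow> real \<Rightarrow> (nat \<Rightarrow> int) \<Rightarrow> (nat \<Rightarrow> int) \<Rightarrow> real" where
  "product_kernel d k t x y = (\<Prod>i<d. coord_kernel k i t (x i) (y i))"

lemma eval_fps_prod:
  fixes f :: "'b \<Rightarrow> real fps"
  assumes "\<And>i. i \<in> I \<Longrightarrow> fps_conv_radius (f i) = \<infinity>"
  shows "fps_conv_radius (\<Prod>i\<in>I. f i) = \<infinity> \<and> eval_fps (\<Prod>i\<in>I. f i) t = (\<Prod>i\<in>I. eval_fps (f i) t)"
  using assms
proof (induction I rule: infinite_finite_induct)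
  case (insert a I)
  then have "fps_conv_radius (f a) = \<infinity>" "fps_conv_radius (\<Prod>i\<in>I. f i) = \<infinity>" by auto
  then show ?case
    using insert fps_conv_radius_mult[of "f a" "\<Prod>i\<in>I. f i"] by (simp add: eval_fps_mult)
qed auto

text \<open>This conditions on the number \<open>n\<close> of jumps before time \<open>t\<close>:
  for points of the orthant, \<open>walk_fps_killed_prob\<close> makes the \<open>n\<close>-th term
  the Poisson weight of parameter \<open>2 * real d * t\<close> times the killed
  probability.\<close>

lemma product_kernel_sums:
  "(\<lambda>n. exp (- (2 * real d * t)) * (walk_fps d k x y $ n * t ^ n)) sums product_kernel d k t x y"
proof -
  note * = eval_fps_prod[where I = "{..<d}" and f = "\<lambda>i. coord_fps k i (x i) (y i)" and t = t,
      OF coord_fps_conv_radius, folded walk_fps_def]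
  have "product_kernel d k t x y = exp (- 2 * t) ^ d * eval_fps (walk_fps d k x y) t"
    by (simp add: * product_kernel_def coord_kernel_eq prod.distrib)
  also have "exp (- 2 * t) ^ d = exp (- (2 * real d * t))"
    by (simp add: exp_of_nat_mult[symmetric] mult_ac)
  finally have eq: "product_kernel d k t x y = exp (- (2 * real d * t)) * eval_fps (walk_fps d k x y) t" .
  show ?thesis
    unfolding eq by (intro sums_mult sums_eval_fps) (simp add: *)
qed

text \<open>Each Poisson weight integrates over time to \<open>1 / (2 * real d)\<close>, the mean
  time spent at the \<open>n\<close>-th position, which is exactly the normalisation in
  \<open>green\<close>. Nonnegative extended integrals allow the exchange of sum and integral before
  convergence is known. The hypothesis \<open>fin\<close> then yields summability, without which the
  real \<open>suminf\<close> in \<open>green\<close> need not be the sum.\<close>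

lemma green_eq_integral:
  assumes "d > 0" "k \<le> d" and x: "x \<in> orthant d k" and y: "y \<in> orthant d k"
    and fin: "(\<integral>\<^sup>+t. ennreal (indicator {0..} t * product_kernel d k t x y) \<partial>lborel) < \<infinity>"
  shows "(\<integral>\<^sup>+t. ennreal (indicator {0..} t * product_kernel d k t x y) \<partial>lborel)
     = ennreal (green d (orthant d k) x y)"
    and "green d (orthant d k) x y \<ge> 0"
proof -
  let ?p = "\<lambda>n. killed_prob d (orthant d k) n x y"
  let ?I = "\<integral>\<^sup>+t. ennreal (indicator {0..} t * product_kernel d k t x y) \<partial>lborel"
  have D: "2 * real d > 0" using assms(1) by simp
  have coef: "?p n * (2 * real d) ^ n = fact n * walk_fps d k x y $ n" for n
    using walk_fps_killed_prob[OF assms(1,2) y, of x n] x by (force simp: orthant_def mult.commute)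
  have dens: "?p n * erlang_density n (2 * real d) t
      = 2 * real d * (indicator {0..} t * (exp (- (2 * real d * t)) * (walk_fps d k x y $ n * t ^ n)))" for n t
  proof (cases "t < 0")
    case False
    have "?p n * erlang_density n (2 * real d) t
        = 2 * real d * (exp (- (2 * real d * t)) * ((?p n * (2 * real d) ^ n) / fact n * t ^ n))"
      using False by (simp add: erlang_density_def)
    also have "(?p n * (2 * real d) ^ n) / fact n = walk_fps d k x y $ n"
      unfolding coef by simp
    finally show ?thesis using False by simp
  qed (simp add: erlang_density_def)
  have sums: "(\<lambda>n. ?p n * erlang_density n (2 * real d) t)
      sums (2 * real d * (indicator {0..} t * product_kernel d k t x y))" for t
    unfolding dens by (intro sums_mult product_kernel_sums)
  have "(\<integral>\<^sup>+t. ennreal (erlang_density n (2 * real d) t) \<partial>lborel) = 1" for n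
    using nn_integral_erlang_ith_moment[OF D, of n 0] by simp
  then have int: "(\<integral>\<^sup>+t. ennreal (?p n * erlang_density n (2 * real d) t) \<partial>lborel) = ennreal (?p n)" for n
    using D by (simp add: ennreal_mult killed_prob_nonneg nn_integral_cmult)
  have "(\<Sum>n. ennreal (?p n)) = (\<integral>\<^sup>+t. (\<Sum>n. ennreal (?p n * erlang_density n (2 * real d) t)) \<partial>lborel)"
    by (subst nn_integral_suminf) (simp_all add: int)
  also have "\<dots> = (\<integral>\<^sup>+t. ennreal (2 * real d * (indicator {0..} t * product_kernel d k t x y)) \<partial>lborel)"
    using D by (intro nn_integral_cong suminf_ennreal_eq sums) (auto simp: killed_prob_nonneg)
  also have "\<dots> = (\<integral>\<^sup>+t. ennreal (2 * real d) * ennreal (indicator {0..} t * product_kernel d k t x y) \<partial>lborel)"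
    using D by (simp add: ennreal_mult')
  also have "\<dots> = ennreal (2 * real d) * ?I"
  proof (rule nn_integral_cmult)
    \<comment> \<open>Measurability in \<open>t\<close> is inherited from the Erlang densities,
      since the kernel is a pointwise sum of their multiples.\<close>
    have "(\<lambda>t. suminf (\<lambda>n. ?p n * erlang_density n (2 * real d) t) / (2 * real d)) \<in> borel_measurable borel"
      by measurable
    then show "(\<lambda>t. ennreal (indicator {0..} t * product_kernel d k t x y)) \<in> borel_measurable lborel"
      using D by (simp add: sums_unique[OF sums, symmetric])
  qed
  finally have eq: "(\<Sum>n. ennreal (?p n)) = ennreal (2 * real d) * ?I" .
  then have "(\<Sum>n. ennreal (?p n)) \<noteq> top"
    using fin by (simp add: ennreal_mult_eq_top_iff)
  then have summ: "summable ?p" by (intro summable_suminf_not_top killed_prob_nonneg)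
  then show "green d (orthant d k) x y \<ge> 0"
    unfolding green_def by (intro divide_nonneg_nonneg suminf_nonneg killed_prob_nonneg) auto
  have "(\<Sum>n. ennreal (?p n)) = ennreal (\<Sum>n. ?p n)"
    using summ by (intro suminf_ennreal2 killed_prob_nonneg)
  also have "(\<Sum>n. ?p n) = 2 * real d * green d (orthant d k) x y"
    using D by (simp add: green_def)
  finally have "ennreal (2 * real d) * ?I = ennreal (2 * real d) * ennreal (green d (orthant d k) x y)"
    using eq D by (simp add: ennreal_mult')
  then show "?I = ennreal (green d (orthant d k) x y)"
    using D by (subst (asm) ennreal_mult_cancel_left) auto
qed

section \<open>Two-sided bounds\<close>

lemma edist_nonneg: "edist d x y \<ge> 0"
  by (simp add: edist_def sum_nonneg)

lemma edist_le_sum: "edist d x y \<le> (\<Sum>i<d. of_int \<bar>x i - y i\<bar>)"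
  using L2_set_le_sum_abs[of "\<lambda>i. of_int (x i - y i)" "{..<d}"] by (simp add: edist_def L2_set_def)

lemma coord_le_edist: "i < d \<Longrightarrow> of_int \<bar>x i - y i\<bar> \<le> edist d x y"
  using member_le_L2_set[of "{..<d}" i "\<lambda>i. of_int \<bar>x i - y i\<bar>"] by (simp add: edist_def L2_set_def)

lemma power_div_fact_le_exp:
  assumes "(x::real) \<ge> 0"
  shows "x ^ n / fact n \<le> exp x"
proof -
  have "(\<Sum>i\<in>{n}. x ^ i /\<^sub>R fact i) \<le> (\<Sum>i. x ^ i /\<^sub>R fact i)"
    using assms by (intro sum_le_suminf summable_exp_generic) auto
  then show ?thesis by (simp add: exp_def divide_inverse mult.commute)
qed

lemma inverse_sqrt_power_eq_powr:
  assumes "t > 0"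
  shows "1 / sqrt t ^ n = t powr (- real n / 2)"
proof -
  have "sqrt t ^ n = sqrt t powr real n" using assms by (simp add: powr_realpow)
  also have "\<dots> = t powr (real n / 2)" using assms by (simp add: powr_half_sqrt[symmetric] powr_powr)
  finally show ?thesis by (simp add: powr_minus_divide)
qed

lemma prod_lessThan_if:
  fixes f :: "nat \<Rightarrow> real"
  assumes "k \<le> d"
  shows "(\<Prod>i<d. if i < k then f i else 1) = (\<Prod>i<k. f i)"
proof -
  have "{..<d} \<inter> {i. i < k} = {..<k}" using assms by auto
  then show ?thesis by (simp add: prod.If_cases)
qed

definition boundary_factor :: "nat \<Rightarrow> (nat \<Rightarrow> int) \<Rightarrow> (nat \<Rightarrow> int) \<Rightarrow> real \<Rightarrow> real" where
  "boundary_factor k x y s = (\<Prod>i<k. min 1 (of_int (x i * y i) / s))"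

text \<open>The first factor is \<open>exp 3\<close> per coordinate from \<open>heat_le\<close>;
  \<open>exp 1\<close> pays for replacing \<open>edist d x y\<close> by
  \<open>1 + edist d x y\<close> in the exponent; the rest bounds
  \<open>v ^ (2 * k + d) * exp (- v / 2)\<close> over \<open>v \<ge> 0\<close>.\<close>

definition upper_const :: "nat \<Rightarrow> nat \<Rightarrow> real" where
  "upper_const d k = exp (3 * real d) * (exp 1 * (2 ^ (2 * k + d) * fact (2 * k + d)))"

text \<open>6144 comes from \<open>killed_heat_ge\<close>, and 12 and 128 from comparing
  \<open>sqrt t\<close> with \<open>\<rho>\<close> and \<open>t\<close> with \<open>\<rho>\<close>
  squared on the time window of the lower bound.\<close>

definition lower_const :: real where
  "lower_const = 1 / (6144 * 12 * 128)"

section \<open>Kernel and integral bounds for a fixed pair of points\<close>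

context
  fixes d k :: nat and x y :: "nat \<Rightarrow> int" and \<rho> :: real
  assumes kd: "k \<le> d" and x: "x \<in> orthant d k" and y: "y \<in> orthant d k"
  defines "\<rho> \<equiv> 1 + edist d x y"
begin

lemma rho_ge_1: "\<rho> \<ge> 1"
  by (simp add: \<rho>_def edist_nonneg)

lemma orthant_ge_1:
  assumes "i < k" shows "x i \<ge> 1" "y i \<ge> 1" "(of_int (x i * y i) :: real) \<ge> 1"
proof -
  show xy: "x i \<ge> 1" "y i \<ge> 1" using x y assms by (auto simp: orthant_def)
  then have "1 \<le> x i * y i" using mult_mono[of 1 "x i" 1 "y i"] by simp
  then show "(of_int (x i * y i) :: real) \<ge> 1" by linarith
qed

lemma boundary_factor_nonneg: "s > 0 \<Longrightarrow> boundary_factor k x y s \<ge> 0"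
  unfolding boundary_factor_def
  using orthant_ge_1(3) by (intro prod_nonneg) (force intro!: divide_nonneg_pos)

lemma boundary_factor_antimono:
  assumes "0 < s" "s \<le> s'"
  shows "boundary_factor k x y s' \<le> boundary_factor k x y s"
  unfolding boundary_factor_def
proof (intro prod_mono conjI)
  fix i assume "i \<in> {..<k}"
  then have 1: "(of_int (x i * y i) :: real) \<ge> 1" using orthant_ge_1(3) by simp
  then show "0 \<le> min 1 (of_int (x i * y i) / s')" using assms by simp
  have "of_int (x i * y i) / s' \<le> of_int (x i * y i) / s"
    using 1 assms by (intro divide_left_mono) auto
  then show "min 1 (of_int (x i * y i) / s') \<le> min 1 (of_int (x i * y i) / s)" by linarith
qed

text \<open>Each coordinate loses at most a factor \<open>u\<close>, because
  \<open>u * min 1 (X / (u * s)) = min u (X / s)\<close>. This moves the boundary factor from an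
  early time to the scale of the distance.\<close>

lemma boundary_factor_scale:
  assumes "0 < s" "u \<ge> 1"
  shows "boundary_factor k x y s \<le> u ^ k * boundary_factor k x y (u * s)"
proof -
  have "boundary_factor k x y s \<le> (\<Prod>i<k. u * min 1 (of_int (x i * y i) / (u * s)))"
    unfolding boundary_factor_def
  proof (intro prod_mono conjI)
    fix i assume "i \<in> {..<k}"
    then have 1: "(of_int (x i * y i) :: real) \<ge> 1" using orthant_ge_1(3) by simp
    then show "0 \<le> min 1 (of_int (x i * y i) / s)" using assms by simp
    have "u * min 1 (of_int (x i * y i) / (u * s)) = min u (of_int (x i * y i) / s)"
      using assms by (simp add: min_mult_distrib_left)
    then show "min 1 (of_int (x i * y i) / s) \<le> u * min 1 (of_int (x i * y i) / (u * s))"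
      using assms by linarith
  qed
  then show ?thesis by (simp add: boundary_factor_def prod.distrib)
qed

lemma product_kernel_le:
  assumes "t \<ge> 0"
  shows "product_kernel d k t x y \<le> exp (3 * real d) * boundary_factor k x y (max 1 t) *
     (exp (- edist d x y / (2 * sqrt (max 1 t))) / sqrt (max 1 t) ^ d)"
proof -
  define r where "r = sqrt (max 1 t)"
  have r: "r \<ge> 1" by (simp add: r_def)
  let ?m = "\<lambda>i. if i < k then min 1 (of_int (x i * y i) / max 1 t) else 1"
  have "product_kernel d k t x y \<le>
      (\<Prod>i<d. ?m i * (exp 3 / r * exp (- of_int \<bar>x i - y i\<bar> / (2 * r))))"
    unfolding product_kernel_def
  proof (intro prod_mono conjI)
    fix i
    show "0 \<le> coord_kernel k i t (x i) (y i)"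
      using assms orthant_ge_1 by (intro coord_kernel_nonneg) auto
    have m: "0 \<le> ?m i" using orthant_ge_1(3)[of i] by auto
    have "coord_kernel k i t (x i) (y i) \<le> ?m i * heat t (x i - y i)"
      using killed_heat_le[of "x i" "y i" t] orthant_ge_1[of i] assms by (auto simp: coord_kernel_def)
    also have "\<dots> \<le> ?m i * (exp 3 / r * exp (- of_int \<bar>x i - y i\<bar> / (2 * r)))"
      unfolding r_def using m assms by (intro mult_left_mono heat_le) auto
    finally show "coord_kernel k i t (x i) (y i) \<le>
        ?m i * (exp 3 / r * exp (- of_int \<bar>x i - y i\<bar> / (2 * r)))" .
  qed
  also have "\<dots> = boundary_factor k x y (max 1 t) * ((exp 3 / r) ^ d *
      exp (\<Sum>i<d. - of_int \<bar>x i - y i\<bar> / (2 * r)))"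
    unfolding prod.distrib prod_lessThan_if[OF kd] boundary_factor_def exp_sum[OF finite_lessThan] by simp
  also have "\<dots> \<le> boundary_factor k x y (max 1 t) * ((exp 3 / r) ^ d * exp (- edist d x y / (2 * r)))"
  proof (intro mult_left_mono boundary_factor_nonneg)
    have "(\<Sum>i<d. - of_int \<bar>x i - y i\<bar> / (2 * r)) = - (\<Sum>i<d. of_int \<bar>x i - y i\<bar>) / (2 * r)"
      unfolding sum_divide_distrib[symmetric] sum_negf ..
    also have "\<dots> \<le> - edist d x y / (2 * r)"
      using edist_le_sum[of d x y] r by (intro divide_right_mono) auto
    finally show "exp (\<Sum>i<d. - of_int \<bar>x i - y i\<bar> / (2 * r)) \<le> exp (- edist d x y / (2 * r))"
      by simp
  qed (use r in auto)
  finally show ?thesis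
    by (simp add: r_def power_divide exp_of_nat_mult[symmetric] mult_ac)
qed

lemma upper_const_ge: "upper_const d k \<ge> exp (3 * real d)"
proof -
  have "1 * 1 \<le> exp 1 * (2 ^ (2 * k + d) * fact (2 * k + d) :: real)"
    by (intro mult_mono) (auto intro: mult_ge1_I)
  then show ?thesis by (simp add: upper_const_def)
qed

text \<open>Let \<open>v\<close> be the ratio of \<open>\<rho>\<close> to the diffusive length.
  Moving the boundary factor to the scale of \<open>\<rho>\<close> costs \<open>v ^ (2 * k)\<close>,
  and moving the prefactor costs \<open>v ^ d\<close>; the off-diagonal decay
  \<open>exp (- v / 2)\<close> absorbs both, so the bound is uniform in \<open>t\<close>.\<close>

lemma product_kernel_le_small:
  assumes "t \<ge> 0" "t \<le> \<rho>\<^sup>2"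
  shows "product_kernel d k t x y \<le> upper_const d k * boundary_factor k x y (\<rho>\<^sup>2) / \<rho> ^ d"
proof -
  define r where "r = sqrt (max 1 t)"
  define v where "v = \<rho> / r"
  have r: "r \<ge> 1" "r\<^sup>2 = max 1 t" by (auto simp: r_def)
  have "r \<le> sqrt (\<rho>\<^sup>2)" unfolding r_def using assms rho_ge_1 by (intro real_sqrt_le_mono) auto
  then have "r \<le> \<rho>" using rho_ge_1 by simp
  then have v: "v \<ge> 1" using r by (simp add: v_def)
  have W: "boundary_factor k x y (\<rho>\<^sup>2) \<ge> 0" using rho_ge_1 by (intro boundary_factor_nonneg) auto
  have 1: "boundary_factor k x y (max 1 t) \<le> v ^ (2 * k) * boundary_factor k x y (\<rho>\<^sup>2)"
  proof -
    have "v\<^sup>2 * max 1 t = \<rho>\<^sup>2" using r by (simp add: v_def power_divide flip: r(2))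
    moreover have "1 \<le> v\<^sup>2" using v by simp
    ultimately show ?thesis
      using boundary_factor_scale[of "max 1 t" "v\<^sup>2"] by (simp add: power_mult)
  qed
  have 2: "exp (- edist d x y / (2 * r)) \<le> exp 1 * exp (- v / 2)"
  proof -
    have "- edist d x y / (2 * r) = 1 / (2 * r) - v / 2"
      using r by (simp add: v_def \<rho>_def field_simps)
    also have "\<dots> \<le> 1 - v / 2" using r by (simp add: field_simps)
    finally show ?thesis by (simp add: exp_add[symmetric])
  qed
  have 3: "v ^ (2 * k + d) * exp (- v / 2) \<le> 2 ^ (2 * k + d) * fact (2 * k + d)"
    using power_div_fact_le_exp[of "v / 2" "2 * k + d"] v
    by (simp add: exp_minus field_simps power_divide)
  have 4: "1 / r ^ d = v ^ d / \<rho> ^ d" using r rho_ge_1 by (simp add: v_def power_divide)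
  have "product_kernel d k t x y \<le> exp (3 * real d) * boundary_factor k x y (max 1 t) *
     (exp (- edist d x y / (2 * r)) * (1 / r ^ d))"
    using product_kernel_le[OF assms(1)] by (simp add: r_def)
  also have "\<dots> \<le> exp (3 * real d) * (v ^ (2 * k) * boundary_factor k x y (\<rho>\<^sup>2)) *
     (exp 1 * exp (- v / 2) * (1 / r ^ d))"
    using 1 2 W v r by (intro mult_mono mult_left_mono mult_right_mono) auto
  also have "\<dots> = exp (3 * real d) * exp 1 * (v ^ (2 * k + d) * exp (- v / 2)) *
      (boundary_factor k x y (\<rho>\<^sup>2) / \<rho> ^ d)"
    unfolding 4 power_add by (simp add: mult_ac)
  also have "\<dots> \<le> exp (3 * real d) * exp 1 * (2 ^ (2 * k + d) * fact (2 * k + d)) *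
      (boundary_factor k x y (\<rho>\<^sup>2) / \<rho> ^ d)"
    using 3 W rho_ge_1 by (intro mult_right_mono mult_left_mono divide_nonneg_nonneg) auto
  also have "\<dots> = upper_const d k * boundary_factor k x y (\<rho>\<^sup>2) / \<rho> ^ d"
    by (simp add: upper_const_def mult.assoc)
  finally show ?thesis .
qed

lemma product_kernel_le_large:
  assumes "t \<ge> \<rho>\<^sup>2"
  shows "product_kernel d k t x y \<le> upper_const d k * boundary_factor k x y (\<rho>\<^sup>2) * t powr (- real d / 2)"
proof -
  have "\<rho>\<^sup>2 \<ge> 1" using rho_ge_1 by simp
  then have t: "t \<ge> 1" "max 1 t = t" using assms by auto
  have W: "boundary_factor k x y (\<rho>\<^sup>2) \<ge> 0" using rho_ge_1 by (intro boundary_factor_nonneg) auto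
  have "product_kernel d k t x y \<le> exp (3 * real d) * boundary_factor k x y t *
     (exp (- edist d x y / (2 * sqrt t)) * (1 / sqrt t ^ d))"
    using product_kernel_le[of t] t by simp
  also have "\<dots> \<le> upper_const d k * boundary_factor k x y (\<rho>\<^sup>2) * (1 * (1 / sqrt t ^ d))"
    using upper_const_ge W t assms rho_ge_1 edist_nonneg[of d x y]
    by (intro mult_mono boundary_factor_antimono mult_nonneg_nonneg boundary_factor_nonneg)
       (auto intro: order_trans[OF exp_ge_zero])
  finally show ?thesis using inverse_sqrt_power_eq_powr[of t d] t by simp
qed

text \<open>The short times contribute their length, \<open>\<rho>\<close> squared, against
  \<open>\<rho> ^ d\<close> in the denominator. The tail contributes the same power divided by
  \<open>real d / 2 - 1\<close>, which is at least \<open>1 / 2\<close> for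
  \<open>d \<ge> 3\<close>; hence \<open>3 = 1 + 2\<close>.\<close>

lemma integral_product_kernel_le:
  assumes "d \<ge> 3"
  shows "(\<integral>\<^sup>+t. ennreal (indicator {0..} t * product_kernel d k t x y) \<partial>lborel)
    \<le> ennreal (3 * upper_const d k * (\<rho> powr (2 - real d) * boundary_factor k x y (\<rho>\<^sup>2)))"
proof -
  define K where "K = upper_const d k * boundary_factor k x y (\<rho>\<^sup>2)"
  have W: "boundary_factor k x y (\<rho>\<^sup>2) \<ge> 0" using rho_ge_1 by (intro boundary_factor_nonneg) auto
  have K: "K \<ge> 0" unfolding K_def using upper_const_ge W
    by (intro mult_nonneg_nonneg) (auto intro: order_trans[OF exp_ge_zero])
  have rho: "\<rho> > 0" using rho_ge_1 by simp
  have "(\<integral>\<^sup>+t. ennreal (indicator {\<rho>\<^sup>2..} t * t powr (- real d / 2)) \<partial>lborel)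
      = ennreal (- ((\<rho>\<^sup>2) powr (- real d / 2 + 1)) / (- real d / 2 + 1))"
    using assms rho by (intro nn_integral_has_integral_lebesgue has_integral_powr_to_inf) auto
  also have "(\<rho>\<^sup>2) powr (- real d / 2 + 1) = \<rho> powr (2 - real d)"
  proof -
    have "\<rho>\<^sup>2 = \<rho> powr 2" using rho by simp
    moreover have "2 * (- real d / 2 + 1) = 2 - real d" by simp
    ultimately show ?thesis by (simp only: powr_powr)
  qed
  also have "- (\<rho> powr (2 - real d)) / (- real d / 2 + 1) = \<rho> powr (2 - real d) / (real d / 2 - 1)"
    using assms by (simp add: field_simps)
  also have "ennreal (\<rho> powr (2 - real d) / (real d / 2 - 1)) \<le> ennreal (2 * \<rho> powr (2 - real d))"
  proof (rule ennreal_leI)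
    have "\<rho> powr (2 - real d) * 1 \<le> \<rho> powr (2 - real d) * (2 * (real d / 2 - 1))"
      using assms by (intro mult_left_mono) auto
    moreover have "real d / 2 - 1 > 0" using assms by simp
    ultimately show "\<rho> powr (2 - real d) / (real d / 2 - 1) \<le> 2 * \<rho> powr (2 - real d)"
      by (simp only: pos_divide_le_eq mult_1_right mult_ac)
  qed
  finally have tail: "(\<integral>\<^sup>+t. ennreal (indicator {\<rho>\<^sup>2..} t * t powr (- real d / 2)) \<partial>lborel)
      \<le> ennreal (2 * \<rho> powr (2 - real d))" .
  have "(\<integral>\<^sup>+t. ennreal (indicator {0..} t * product_kernel d k t x y) \<partial>lborel) \<le>
    (\<integral>\<^sup>+t. ennreal (K / \<rho> ^ d) * indicator {0..\<rho>\<^sup>2} t +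
       ennreal K * ennreal (indicator {\<rho>\<^sup>2..} t * t powr (- real d / 2)) \<partial>lborel)"
  proof (rule nn_integral_mono)
    fix t
    consider "t < 0" | "0 \<le> t" "t \<le> \<rho>\<^sup>2" | "t > \<rho>\<^sup>2" "t \<ge> 0"
      using zero_le_power2[of \<rho>] by linarith
    then show "ennreal (indicator {0..} t * product_kernel d k t x y) \<le>
      ennreal (K / \<rho> ^ d) * indicator {0..\<rho>\<^sup>2} t +
       ennreal K * ennreal (indicator {\<rho>\<^sup>2..} t * t powr (- real d / 2))"
    proof cases
      case 2
      then have "ennreal (product_kernel d k t x y) \<le> ennreal (K / \<rho> ^ d)"
        using product_kernel_le_small by (intro ennreal_leI) (simp add: K_def)
      then show ?thesis using 2 by (auto intro: add_increasing2)
    next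
      case 3
      then have "ennreal (product_kernel d k t x y) \<le> ennreal (K * t powr (- real d / 2))"
        using product_kernel_le_large by (intro ennreal_leI) (simp add: K_def)
      then show ?thesis using 3 K by (simp add: ennreal_mult)
    qed simp
  qed
  also have "\<dots> = ennreal (K / \<rho> ^ d) * ennreal (\<rho>\<^sup>2) +
       ennreal K * (\<integral>\<^sup>+t. ennreal (indicator {\<rho>\<^sup>2..} t * t powr (- real d / 2)) \<partial>lborel)"
    by (subst nn_integral_add) (auto simp: nn_integral_cmult)
  also have "\<dots> \<le> ennreal (K / \<rho> ^ d) * ennreal (\<rho>\<^sup>2) + ennreal K * ennreal (2 * \<rho> powr (2 - real d))"
    by (intro add_left_mono mult_left_mono tail) simp
  also have "\<dots> = ennreal (K / \<rho> ^ d * \<rho>\<^sup>2 + K * (2 * \<rho> powr (2 - real d)))"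
    using K rho by (simp add: ennreal_mult[symmetric] ennreal_plus[symmetric] del: ennreal_plus)
  also have "K / \<rho> ^ d * \<rho>\<^sup>2 = K * \<rho> powr (2 - real d)"
    using rho by (simp add: powr_diff powr_realpow)
  also have "K * \<rho> powr (2 - real d) + K * (2 * \<rho> powr (2 - real d)) = 3 * (K * \<rho> powr (2 - real d))"
    by simp
  finally show ?thesis by (simp only: K_def mult_ac)
qed

lemma product_kernel_ge:
  assumes "64 * \<rho>\<^sup>2 \<le> t" "t \<le> 128 * \<rho>\<^sup>2"
  shows "product_kernel d k t x y \<ge> boundary_factor k x y (\<rho>\<^sup>2) * (lower_const / \<rho>) ^ d"
proof -
  let ?m = "\<lambda>i. if i < k then min 1 (of_int (x i * y i) / \<rho>\<^sup>2) else 1"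
  \<comment> \<open>128 is relaxed to the perfect square 144 so that both roots are integer
    multiples of \<open>\<rho>\<close>.\<close>
  have "sqrt (64 * \<rho>\<^sup>2) \<le> sqrt t" "sqrt t \<le> sqrt (144 * \<rho>\<^sup>2)"
    using assms rho_ge_1 by (intro real_sqrt_le_mono; simp)+
  moreover have "sqrt (64 * \<rho>\<^sup>2) = 8 * \<rho>" "sqrt (144 * \<rho>\<^sup>2) = 12 * \<rho>"
    using rho_ge_1 by (auto intro!: real_sqrt_unique simp: power_mult_distrib)
  ultimately have rt: "8 * \<rho> \<le> sqrt t" "sqrt t \<le> 12 * \<rho>" by auto
  have t: "t > 0" using assms rho_ge_1 by (smt (verit) zero_less_power)
  have "boundary_factor k x y (\<rho>\<^sup>2) * (lower_const / \<rho>) ^ d = (\<Prod>i<d. ?m i * (lower_const / \<rho>))"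
    by (simp only: prod.distrib prod_lessThan_if[OF kd] boundary_factor_def prod_constant card_lessThan)
  also have "\<dots> \<le> product_kernel d k t x y"
    unfolding product_kernel_def
  proof (intro prod_mono conjI)
    fix i assume "i \<in> {..<d}"
    then have dist: "1 + of_int \<bar>x i - y i\<bar> \<le> \<rho>"
      using coord_le_edist[of i d x y] by (simp add: \<rho>_def)
    show "0 \<le> ?m i * (lower_const / \<rho>)"
      using orthant_ge_1(3)[of i] rho_ge_1 by (auto simp: lower_const_def)
    show "?m i * (lower_const / \<rho>) \<le> coord_kernel k i t (x i) (y i)"
    proof (cases "i < k")
      case True
      define X where "X = (of_int (x i * y i) :: real)"
      have X: "X \<ge> 1" using orthant_ge_1(3)[OF True] by (simp add: X_def)
      have "min 1 (X / \<rho>\<^sup>2) / 128 \<le> min 1 (X / t)"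
      proof -
        have "X / \<rho>\<^sup>2 / 128 \<le> X / t"
          using X t assms(2) rho_ge_1 by (simp add: divide_divide_eq_left mult.commute) (intro divide_left_mono, auto)
        moreover have "min 1 Y / 128 \<le> min 1 Z" if "Y / 128 \<le> Z" for Y Z :: real
          using that by (auto simp: min_def)
        ultimately show ?thesis by blast
      qed
      then have "min 1 (X / \<rho>\<^sup>2) / 128 / (6144 * (12 * \<rho>)) \<le> min 1 (X / t) / (6144 * sqrt t)"
        using X t rt by (intro frac_le) auto
      also have "\<dots> \<le> killed_heat t (x i) (y i)"
        unfolding X_def
      proof (rule killed_heat_ge)
        have "(1 + real_of_int \<bar>x i - y i\<bar>)\<^sup>2 \<le> \<rho>\<^sup>2" using dist by (intro power_mono) auto
        then show "64 * (1 + real_of_int \<bar>x i - y i\<bar>)\<^sup>2 \<le> t" using assms(1) by linarith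
      qed (use orthant_ge_1[OF True] in auto)
      finally show ?thesis
        using True by (simp add: coord_kernel_def lower_const_def X_def mult_ac)
    next
      case False
      \<comment> \<open>For a free coordinate \<open>1 / (24 * 12)\<close> would do; the smaller
        constant is kept so that all \<open>d\<close> factors share the same one.\<close>
      have "lower_const / \<rho> \<le> 1 / (24 * sqrt t)"
        using rt t rho_ge_1 by (simp add: lower_const_def field_simps)
      also have "\<dots> \<le> heat t (x i - y i)"
        using dist rt rho_ge_1 by (intro heat_ge) linarith
      finally show ?thesis using False by (simp add: coord_kernel_def)
    qed
  qed
  finally show ?thesis .
qed

lemma integral_product_kernel_ge:
  "(\<integral>\<^sup>+t. ennreal (indicator {0..} t * product_kernel d k t x y) \<partial>lborel)
    \<ge> ennreal (64 * lower_const ^ d * (\<rho> powr (2 - real d) * boundary_factor k x y (\<rho>\<^sup>2)))"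
proof -
  define L where "L = boundary_factor k x y (\<rho>\<^sup>2) * (lower_const / \<rho>) ^ d"
  have rho: "\<rho> > 0" using rho_ge_1 by simp
  have L: "L \<ge> 0" unfolding L_def using rho boundary_factor_nonneg[of "\<rho>\<^sup>2"]
    by (simp add: lower_const_def)
  have "64 * lower_const ^ d * (\<rho> powr (2 - real d) * boundary_factor k x y (\<rho>\<^sup>2)) = L * (64 * \<rho>\<^sup>2)"
    using rho by (simp add: L_def powr_diff powr_realpow power_divide)
  also have "ennreal (L * (64 * \<rho>\<^sup>2)) = ennreal L * emeasure lborel {64 * \<rho>\<^sup>2..128 * \<rho>\<^sup>2}"
    using L by (simp add: ennreal_mult)
  also have "\<dots> = (\<integral>\<^sup>+t. ennreal L * indicator {64 * \<rho>\<^sup>2..128 * \<rho>\<^sup>2} t \<partial>lborel)"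
    by (simp add: nn_integral_cmult_indicator)
  also have "\<dots> \<le> (\<integral>\<^sup>+t. ennreal (indicator {0..} t * product_kernel d k t x y) \<partial>lborel)"
  proof (rule nn_integral_mono)
    fix t
    show "ennreal L * indicator {64 * \<rho>\<^sup>2..128 * \<rho>\<^sup>2} t \<le> ennreal (indicator {0..} t * product_kernel d k t x y)"
    proof (cases "t \<in> {64 * \<rho>\<^sup>2..128 * \<rho>\<^sup>2}")
      case True
      then have "L \<le> product_kernel d k t x y" using product_kernel_ge by (simp add: L_def)
      moreover have "t \<ge> 0" using True zero_le_power2[of \<rho>] by auto
      ultimately show ?thesis using True by (simp add: ennreal_leI)
    qed simp
  qed
  finally show ?thesis .
qed

end

theorem theorem8p3:
  fixes d k :: nat
  assumes "d \<ge> 3" and "1 \<le> k" and "k \<le> d"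
  shows "\<exists>C>0. \<forall>x\<in>orthant d k. \<forall>y\<in>orthant d k.
     (let g = (1 + edist d x y) powr (2 - real d) *
              (\<Prod>i<k. min 1 (real_of_int (x i * y i) / (1 + edist d x y)\<^sup>2))
      in g / C \<le> green d (orthant d k) x y \<and> green d (orthant d k) x y \<le> C * g)"
proof -
  define C where "C = max (3 * upper_const d k) (1 / (64 * lower_const ^ d))"
  have C0: "1 / (64 * lower_const ^ d) > 0" by (simp add: lower_const_def)
  then have C: "C > 0" unfolding C_def less_max_iff_disj by blast
  have "g / C \<le> green d (orthant d k) x y \<and> green d (orthant d k) x y \<le> C * g"
    if x: "x \<in> orthant d k" and y: "y \<in> orthant d k"
      and g: "g = (1 + edist d x y) powr (2 - real d) * boundary_factor k x y ((1 + edist d x y)\<^sup>2)" for x y g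
  proof -
    let ?G = "green d (orthant d k) x y"
    have "edist d x y \<ge> 0" by (rule edist_nonneg)
    then have g0: "g \<ge> 0"
      unfolding g by (intro mult_nonneg_nonneg boundary_factor_nonneg[OF assms(3) x y]) auto
    note up = integral_product_kernel_le[OF assms(3) x y assms(1), folded g]
    note low = integral_product_kernel_ge[OF assms(3) x y, folded g]
    \<comment> \<open>The upper bound comes before the identification with the Green function,
      because it supplies the finiteness which that identification requires.\<close>
    have eq: "(\<integral>\<^sup>+t. ennreal (indicator {0..} t * product_kernel d k t x y) \<partial>lborel) = ennreal ?G"
      and G0: "?G \<ge> 0"
      using green_eq_integral[OF _ assms(3) x y] assms(1) le_less_trans[OF up] by auto
    have "?G \<le> 3 * upper_const d k * g"
    proof -
      have "0 \<le> 3 * upper_const d k * g" using g0 by (simp add: upper_const_def)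
      then show ?thesis using up unfolding eq by (subst (asm) ennreal_le_iff) auto
    qed
    also have "\<dots> \<le> C * g" using g0 by (intro mult_right_mono) (auto simp: C_def)
    finally have 1: "?G \<le> C * g" .
    have "g / C \<le> g / (1 / (64 * lower_const ^ d))"
      by (rule divide_left_mono[OF _ g0 mult_pos_pos[OF C C0]]) (simp add: C_def)
    also have "\<dots> = 64 * lower_const ^ d * g" by simp
    also have "\<dots> \<le> ?G" using low G0 unfolding eq by (subst (asm) ennreal_le_iff) auto
    finally show ?thesis using 1 by simp
  qed
  then show ?thesis using C unfolding boundary_factor_def Let_def by blast
qed

end
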